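(* Let $d\geq 3$ and $s\in\mathbb{N}$ be integers, and let $$\psi_{s,d}(q)=\left(\frac{1}{q\,(\log q)(\log\log q)\cdots(\log^{s} q)}\right)^{1/d},$$ where $\log^{s}$ denotes the $s$-fold iterated logarithm. Let $x\in\mathbb{R}$ be such that either the Diophantine type of $x$ is greater than $d$, or $x$ is irrational and its regular Diophantine type is greater than $1$. Then $\mathcal{W}_d(\psi_{s,d})\cap(\{x\}\times\mathbb{R}^{d-1})$ has full $(d-1)$-dimensional Lebesgue measure in $\{x\}\times\mathbb{R}^{d-1}$; that is, for Lebesgue-almost every $(x_2,\dots,x_d)\in\mathbb{R}^{d-1}$ one has $(x,x_2,\dots,x_d)\in\mathcal{W}_d(\psi_{s,d})$.
   Context: For $\psi:\mathbb{N}\to[0,\infty)$, $\mathcal{W}_d(\psi)$ is the set of $\boldsymbol{x}\in\mathbb{R}^d$ such that $\|q\boldsymbol{x}-\boldsymbol{p}\|_\infty<\psi(q)$ holds for infinitely many $(\boldsymbol{p},q)\in\mathbb{Z}^d\times\mathbb{N}$. The formula for $\psi_{s,d}(q)$ is used for all $q$ large enough that every iterated logarithm occurring is defined and positive; the finitely many remaining values are irrelevant. For $\tau>0$ write $\mathcal{W}_1(\tau)$ for $\mathcal{W}_1(q\mapsto q^{-\tau})$. The Diophantine type of $x\in\mathbb{R}$ is the supremum (in $(0,\infty]$) of all $\tau>0$ with $x\in\mathcal{W}_1(\tau)$. For irrational $x$ let $\{q_n\}_{n\ge0}$ be its continuants, i.e. the denominators of the convergents of its simple continued fraction. The regular Diophantine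 type of $x$ is the supremum of all $\sigma\in[1,\infty)$ for which there is a set (sequence) $\{n_j\}\subseteq\mathbb{N}$ of positive lower asymptotic density with $q_{n_j}^{\sigma}<q_{n_j+1}$ for all $j$. *)

theory Defs
  imports "HOL-Analysis.Analysis"
begin

text \<open>
  Since the dimension is a natural number that may vary, points of \<open>\<real>\<^sup>d\<close> and \<open>\<int>\<^sup>d\<close> are
  functions on the index set \<open>{1..d}\<close>, extended by \<open>undefined\<close> elsewhere.  The positive
  integers \<open>{1, 2, \<dots>}\<close> are meant wherever the mathematics says \<open>\<nat>\<close>.
\<close>

definition sup_norm :: "nat \<Rightarrow> (nat \<Rightarrow> real) \<Rightarrow> real" where
  "sup_norm d v = (MAX i\<in>{1..d}. \<bar>v i\<bar>)"

definition well_approx :: "nat \<Rightarrow> (nat \<Rightarrow> real) \<Rightarrow> (nat \<Rightarrow> real) set" where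
  "well_approx d \<psi> = {x \<in> {1..d} \<rightarrow>\<^sub>E (UNIV :: real set).
     infinite {(p, q). p \<in> {1..d} \<rightarrow>\<^sub>E (UNIV :: int set) \<and> q \<ge> 1 \<and>
       sup_norm d (\<lambda>i. real q * x i - real_of_int (p i)) < \<psi> q}}"

text \<open>
  The value \<open>0\<close> is a placeholder at the finitely many \<open>q\<close> for which some iterated logarithm is
  undefined or not positive; these \<open>q\<close> contribute only finitely many pairs \<open>(p, q)\<close> under any
  other convention.
\<close>

definition psi :: "nat \<Rightarrow> nat \<Rightarrow> nat \<Rightarrow> real" where
  "psi s d q =
     (if \<forall>k\<in>{1..s}. (ln ^^ k) (real q) > 0
      then (1 / (real q * (\<Prod>k=1..s. (ln ^^ k) (real q)))) powr (1 / real d)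
      else 0)"

definition well_approx1 :: "real \<Rightarrow> real set" where
  "well_approx1 \<tau> = {x. (\<lambda>i\<in>{1..1}. x) \<in> well_approx 1 (\<lambda>q. real q powr (- \<tau>))}"

definition diophantine_type :: "real \<Rightarrow> ereal" where
  "diophantine_type x = Sup {ereal \<tau> | \<tau>. \<tau> > 0 \<and> x \<in> well_approx1 \<tau>}"

text \<open>
  Complete quotients of the continued fraction expansion.  Only irrational \<open>x\<close> are of interest;
  for rational \<open>x\<close> the expansion terminates and later values are meaningless.
\<close>

primrec complete_quotient :: "real \<Rightarrow> nat \<Rightarrow> real" where
  "complete_quotient x 0 = x"
| "complete_quotient x (Suc n) = 1 / frac (complete_quotient x n)"

definition partial_quotient :: "real \<Rightarrow> nat \<Rightarrow> int" where
  "partial_quotient x n = \<lfloor>complete_quotient x n\<rfloor>"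

text \<open>\<open>finite_cfrac a n\<close> is the value of \<open>[a 0; a 1, \<dots>, a n]\<close>.\<close>

primrec finite_cfrac :: "(nat \<Rightarrow> int) \<Rightarrow> nat \<Rightarrow> rat" where
  "finite_cfrac a 0 = of_int (a 0)"
| "finite_cfrac a (Suc n) = of_int (a 0) + 1 / finite_cfrac (\<lambda>i. a (Suc i)) n"

definition convergent_of :: "real \<Rightarrow> nat \<Rightarrow> rat" where
  "convergent_of x n = finite_cfrac (partial_quotient x) n"

definition continuant :: "real \<Rightarrow> nat \<Rightarrow> int" where
  "continuant x n = snd (quotient_of (convergent_of x n))"

definition lower_density :: "nat set \<Rightarrow> ereal" where
  "lower_density A = liminf (\<lambda>N. ereal (real (card (A \<inter> {1..N})) / real N))"

definition regular_diophantine_type :: "real \<Rightarrow> ereal" where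
  "regular_diophantine_type x = Sup {ereal \<sigma> | \<sigma>. \<sigma> \<ge> 1 \<and>
     (\<exists>A\<subseteq>{1..}. lower_density A > 0 \<and>
       (\<forall>n\<in>A. real_of_int (continuant x n) powr \<sigma> < real_of_int (continuant x (n + 1))))}"

end

theory Submission
  imports Defs
begin

text \<open>
  If \<open>\<bar>h x - p\<bar> < h powr (- 2 d)\<close> for infinitely many \<open>h\<close>, Dirichlet's theorem applied to \<open>h y\<close>
  shows that every \<open>y\<close> qualifies.  Otherwise let \<open>N = 2 ^ t\<close> and \<open>\<delta> = psi s d N\<close>.  By Dirichlet's
  theorem each \<open>y\<close> lies within about \<open>1 / (q m)\<close> of a rational point \<open>p / q\<close> with \<open>q \<le> N\<close>, where
  \<open>q x\<close> is within \<open>\<delta>\<close> of an integer and \<open>m ^ (d - 1)\<close> is comparable to \<open>N \<delta>\<close>.  For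
  many \<open>t\<close> the denominators \<open>q\<close> much smaller than \<open>N\<close> only serve a small proportion of the \<open>y\<close>.
  Choosing one rational point near each good cell of side \<open>1 / (N m)\<close> gives well separated
  centres of cubes of radius \<open>\<delta> / N\<close>.  These cubes occupy a proportion \<open>N \<delta> ^ d\<close> of every fixed cube,
  they are quasi-independent over different \<open>t\<close> because of the separation, and the sum of
  \<open>N \<delta> ^ d\<close> over these \<open>t\<close> diverges.  So almost every \<open>y\<close> is in infinitely many of them.
\<close>

section \<open>Denominators with small error in one coordinate\<close>

text \<open>The obstacle is the fixed coordinate: only denominators q with q x close to an integer
  can be used, and these may be badly distributed. They are counted in blocks of length H, where H
  is the denominator of a best approximation to x. Multiples of x below H stay 1 / (2 H) away from
  the integers, so a block contains O(\<delta> H) usable denominators as soon as \<delta> H \<ge> 1.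
  As \<delta> is N^(-1/d) up to logarithms, H \<ge> sqrt N yields \<delta> H \<ge> 1 for large N
  because d \<ge> 3. This density is enough: the weights N \<delta>^d = 1 / (log N ... log^s N)
  decrease in t, and their sum over all t diverges like log^(s+1).\<close>

lemma simultaneous_Dirichlet:
  fixes y :: "'a \<Rightarrow> real" and n :: "'a \<Rightarrow> nat"
  assumes J: "finite J" and n: "\<And>j. j \<in> J \<Longrightarrow> n j \<ge> 1" and N: "(\<Prod>j\<in>J. n j) \<le> N"
  shows "\<exists>q\<in>{1..N}. \<forall>j\<in>J. \<exists>p::int. \<bar>real q * y j - p\<bar> < 1 / n j"
proof -
  \<comment> \<open>Pigeonhole: the \<open>N + 1\<close> multiples \<open>0..N\<close> fall into at
    most \<open>N\<close> boxes with sides \<open>1 / n j\<close>. The sides are half-open, which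
    makes the final inequality strict, and may differ, because the fixed coordinate and the free
    ones will need different errors.\<close>
  define g where "g q = (\<lambda>j\<in>J. nat \<lfloor>frac (real q * y j) * n j\<rfloor>)" for q :: nat
  have g_less: "nat \<lfloor>frac (real q * y j) * n j\<rfloor> < n j" if "j \<in> J" for q j
  proof -
    have "frac (real q * y j) * n j < 1 * real (n j)"
      using frac_lt_1 n[OF that] by (intro mult_strict_right_mono) auto
    then show ?thesis
      using frac_ge_0[of "real q * y j"] by (simp add: nat_less_iff floor_less_iff)
  qed
  have "g ` {0..N} \<subseteq> (\<Pi>\<^sub>E j\<in>J. {..<n j})"
    using g_less by (auto simp: g_def)
  then have "card (g ` {0..N}) \<le> card (\<Pi>\<^sub>E j\<in>J. {..<n j})"
    using J by (intro card_mono finite_PiE) auto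
  also have "\<dots> \<le> N"
    using J N by (simp add: card_PiE)
  finally have "\<not> inj_on g {0..N}"
    by (intro pigeonhole) simp
  then obtain a b where ab: "a < b" "b \<le> N" "g a = g b"
    unfolding inj_on_def by (metis atLeastAtMost_iff nat_neq_iff)
  show ?thesis
  proof (rule bexI[of _ "b - a"], intro ballI)
    fix j assume j: "j \<in> J"
    define u v where "u = frac (real a * y j)" and "v = frac (real b * y j)"
    have "nat \<lfloor>u * n j\<rfloor> = nat \<lfloor>v * n j\<rfloor>"
      using fun_cong[OF ab(3), of j] j by (simp add: g_def u_def v_def)
    moreover have "0 \<le> u * n j" "0 \<le> v * n j"
      by (auto simp: u_def v_def)
    ultimately have "\<lfloor>u * n j\<rfloor> = \<lfloor>v * n j\<rfloor>"
      by (metis eq_nat_nat_iff zero_le_floor)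
    then have "\<bar>u * n j - v * n j\<bar> < 1"
      by linarith
    then have "\<bar>v - u\<bar> * n j < 1"
      by (metis abs_minus_commute abs_mult abs_of_nat left_diff_distrib)
    then have "\<bar>v - u\<bar> < 1 / n j"
      using n[OF j] by (simp add: field_simps)
    moreover have "v - u = real (b - a) * y j - (\<lfloor>real b * y j\<rfloor> - \<lfloor>real a * y j\<rfloor>)"
      using ab by (simp add: u_def v_def frac_def of_nat_diff algebra_simps)
    ultimately show "\<exists>p::int. \<bar>real (b - a) * y j - p\<bar> < 1 / n j"
      by metis
  qed (use ab in auto)
qed

text \<open>Two denominators of one block differ by some \<open>h < H\<close>, so their signed
  errors differ by at least \<open>\<beta>\<close>. Hence the errors are
  \<open>\<beta>\<close>-separated points in an interval of length
  \<open>2 * \<delta>\<close>.\<close>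

lemma card_near_integer_block:
  fixes x \<beta> \<delta> :: real
  assumes \<beta>: "\<beta> > 0" and \<delta>: "\<delta> \<ge> 0"
    and sep: "\<And>h p::int. 0 < h \<Longrightarrow> h < int H \<Longrightarrow> \<bar>real_of_int h * x - p\<bar> \<ge> \<beta>"
  shows "real (card {q \<in> {a..<a + H}. \<exists>p::int. \<bar>real q * x - p\<bar> < \<delta>}) \<le> 2 * \<delta> / \<beta> + 1"
proof -
  define S where "S = {q \<in> {a..<a + H}. \<exists>p::int. \<bar>real q * x - p\<bar> < \<delta>}"
  define p where "p q = (SOME p::int. \<bar>real q * x - p\<bar> < \<delta>)" for q
  define f where "f q = real q * x - p q" for q
  have f: "\<bar>f q\<bar> < \<delta>" if "q \<in> S" for q
    using that someI_ex[of "\<lambda>p::int. \<bar>real q * x - p\<bar> < \<delta>"] unfolding S_def f_def p_def by blast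
  define g where "g q = \<lfloor>(f q + \<delta>) / \<beta>\<rfloor>" for q
  have *: False if q: "q \<in> S" "r \<in> S" "q < r" and eq: "g q = g r" for q r
  proof -
    have "\<bar>(f q + \<delta>) / \<beta> - (f r + \<delta>) / \<beta>\<bar> < 1"
      using eq unfolding g_def by linarith
    then have "\<bar>(f r - f q) / \<beta>\<bar> < 1"
      by (simp add: diff_divide_distrib add_divide_distrib)
    then have "\<bar>f r - f q\<bar> < \<beta>"
      using \<beta> by (simp add: field_simps abs_divide)
    moreover have "f r - f q = real_of_int (int r - int q) * x - (p r - p q)"
      by (simp add: f_def algebra_simps)
    ultimately show False
      using sep[of "int r - int q" "p r - p q"] q by (auto simp: S_def)
  qed
  have inj: "inj_on g S"
    by (rule inj_onI) (metis * nat_neq_iff)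
  have "g ` S \<subseteq> {0..\<lfloor>2 * \<delta> / \<beta>\<rfloor>}"
  proof
    fix z assume "z \<in> g ` S"
    then obtain q where q: "q \<in> S" "z = g q" by auto
    have "0 \<le> (f q + \<delta>) / \<beta>" "(f q + \<delta>) / \<beta> \<le> 2 * \<delta> / \<beta>"
      using f[OF q(1)] \<beta> by (auto intro!: divide_right_mono)
    then show "z \<in> {0..\<lfloor>2 * \<delta> / \<beta>\<rfloor>}"
      by (auto simp: q(2) g_def floor_mono)
  qed
  then have "card S \<le> card {0..\<lfloor>2 * \<delta> / \<beta>\<rfloor>}"
    using inj card_mono card_image by (metis finite_atLeastAtMost_int)
  moreover have "real (card {0..\<lfloor>2 * \<delta> / \<beta>\<rfloor>}) \<le> 2 * \<delta> / \<beta> + 1"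
  proof -
    have "0 \<le> \<lfloor>2 * \<delta> / \<beta>\<rfloor>" using \<beta> \<delta> by simp
    then show ?thesis by (simp)
  qed
  ultimately show ?thesis
    unfolding S_def by linarith
qed

text \<open>Continuants have this property: no smaller positive multiple of \<open>x\<close> is
  nearer to an integer than half the reciprocal of the continuant. Working with the property itself
  avoids continued fractions and treats rational \<open>x\<close> alike.\<close>

definition separating :: "real \<Rightarrow> nat \<Rightarrow> bool" where
  "separating x H \<longleftrightarrow> H \<ge> 1 \<and>
     (\<forall>h p::int. 0 < h \<longrightarrow> h < int H \<longrightarrow> \<bar>real_of_int h * x - p\<bar> \<ge> 1 / (2 * real H))"

text \<open>Each block of length \<open>H\<close> contributes at most
  \<open>4 * \<delta> * H + 1 \<le> 5 * \<delta> * H\<close>, and at most \<open>2 * M / H\<close>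
  blocks cover \<open>{1..M}\<close>. Up to the constant this is the count expected of
  equidistributed multiples.\<close>

lemma card_near_integer:
  fixes x \<delta> :: real and H M :: nat
  assumes sep: "separating x H" and MH: "H \<le> M" and \<delta>H: "\<delta> * H \<ge> 1"
  shows "real (card {q \<in> {1..M}. \<exists>p::int. \<bar>real q * x - p\<bar> < \<delta>}) \<le> 10 * M * \<delta>"
proof -
  have H: "H \<ge> 1" using sep by (simp add: separating_def)
  have \<delta>: "\<delta> > 0" using \<delta>H H by (metis less_le_not_le linorder_not_less mult_nonpos_nonneg of_nat_0_le_iff order_trans zero_less_one)
  define B where "B i = {q \<in> {1 + i * H..<1 + i * H + H}. \<exists>p::int. \<bar>real q * x - p\<bar> < \<delta>}" for i
  have B: "real (card (B i)) \<le> 5 * \<delta> * H" for i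
  proof -
    have "real (card (B i)) \<le> 2 * \<delta> / (1 / (2 * real H)) + 1"
      unfolding B_def using sep \<delta> H
      by (intro card_near_integer_block) (auto simp: separating_def)
    also have "\<dots> \<le> 5 * \<delta> * H" using \<delta>H H by (simp add: field_simps)
    finally show ?thesis .
  qed
  have "{q \<in> {1..M}. \<exists>p::int. \<bar>real q * x - p\<bar> < \<delta>} \<subseteq> (\<Union>i\<in>{..M div H}. B i)"
  proof
    fix q assume q: "q \<in> {q \<in> {1..M}. \<exists>p::int. \<bar>real q * x - p\<bar> < \<delta>}"
    define i where "i = (q - 1) div H"
    have "i * H + (q - 1) mod H = q - 1" "(q - 1) mod H < H"
      using H by (auto simp: i_def)
    then have "q \<in> B i" using q by (auto simp: B_def)
    moreover have "i \<le> M div H" using q unfolding i_def by (intro div_le_mono) auto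
    ultimately show "q \<in> (\<Union>i\<in>{..M div H}. B i)" by blast
  qed
  then have "card {q \<in> {1..M}. \<exists>p::int. \<bar>real q * x - p\<bar> < \<delta>} \<le> card (\<Union>i\<in>{..M div H}. B i)"
    by (intro card_mono) (auto simp: B_def)
  also have "\<dots> \<le> (\<Sum>i\<in>{..M div H}. card (B i))"
    by (intro card_UN_le) auto
  finally have "real (card {q \<in> {1..M}. \<exists>p::int. \<bar>real q * x - p\<bar> < \<delta>}) \<le> (\<Sum>i\<in>{..M div H}. real (card (B i)))"
    by (simp flip: of_nat_sum)
  also have "\<dots> \<le> (\<Sum>i\<in>{..M div H}. 5 * \<delta> * H)"
    by (intro sum_mono B)
  also have "\<dots> = (real (M div H) + 1) * H * (5 * \<delta>)"
    by (simp add: algebra_simps)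
  also have "(real (M div H) + 1) * H \<le> 2 * M"
  proof -
    have "(M div H + 1) * H = M div H * H + H" by simp
    also have "\<dots> \<le> 2 * M" using MH div_times_less_eq_dividend[of M H] by linarith
    finally have "(M div H + 1) * H \<le> 2 * M" .
    then show ?thesis by (metis of_nat_1 of_nat_add of_nat_le_iff of_nat_mult of_nat_numeral)
  qed
  then have "(real (M div H) + 1) * H * (5 * \<delta>) \<le> 2 * M * (5 * \<delta>)"
    using \<delta> by (intro mult_right_mono) auto
  finally show ?thesis by (simp add: algebra_simps)
qed

text \<open>
  \<open>H\<close> is the first denominator that improves on all denominators up to \<open>X\<close>.  The fractions
  belonging to \<open>H\<close> and to the best denominator up to \<open>X\<close> are distinct, so their determinant is a
  nonzero integer; this bounds the error of the latter from below.
\<close>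

lemma separating_exists:
  fixes x :: real and X b :: nat
  assumes X: "X \<ge> 1" and b: "b \<ge> 1"
    and lower: "\<And>h p::int. 0 < h \<Longrightarrow> h \<le> int X \<Longrightarrow> \<bar>real_of_int h * x - p\<bar> \<ge> 1 / real b"
  shows "\<exists>H. separating x H \<and> X < H \<and> H \<le> b"
proof -
  define D where "D h = \<bar>real h * x - round (real h * x)\<bar>" for h :: nat
  have D_le: "D h \<le> \<bar>real h * x - p\<bar>" for h and p :: int
    unfolding D_def using round_diff_minimal[of "real h * x" p] by (simp add: abs_minus_commute)
  obtain g where g: "g \<in> {1..X}" and g_min: "\<And>h. h \<in> {1..X} \<Longrightarrow> D g \<le> D h"
    using X by (metis atLeastatMost_empty_iff arg_min_if_finite(1) arg_min_least finite_atLeastAtMost not_less_eq_eq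
        One_nat_def)
  \<comment> \<open>Dirichlet's theorem gives a denominator up to \<open>b\<close> with error below
    \<open>1 / b\<close>, hence below \<open>D g\<close>; so an improvement on \<open>g\<close>
    exists and the least one is at most \<open>b\<close>.\<close>
  obtain r where r: "r \<in> {1..b}" and rp: "\<exists>p::int. \<bar>real r * x - p\<bar> < 1 / real b"
    using simultaneous_Dirichlet[of "{0::nat}" "\<lambda>_. b" b "\<lambda>_. x"] b by fastforce
  have "1 / real b \<le> D g"
    using lower[of "int g" "round (real g * x)"] g by (simp add: D_def)
  with rp D_le have r': "D r < D g" by (meson order_le_less_trans order_less_le_trans)
  define H where "H = (LEAST h. h \<ge> 1 \<and> D h < D g)"
  have H: "H \<ge> 1 \<and> D H < D g" unfolding H_def by (rule LeastI[of _ r]) (use r r' in auto)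
  have H_least: "D g \<le> D h" if "1 \<le> h" "h < H" for h
    using not_less_Least[of h "\<lambda>h. h \<ge> 1 \<and> D h < D g"] that unfolding H_def by auto
  have "H \<le> r" unfolding H_def using r r' by (intro Least_le) auto
  have XH: "X < H" using H g_min[of H] by (meson atLeastAtMost_iff leI linorder_not_less)
  have Dg: "D g \<ge> 1 / (2 * real H)"
  proof -
    define p p' where "p = round (real g * x)" and "p' = round (real H * x)"
    \<comment> \<open>If the two fractions agreed, errors would be proportional to denominators, and
      \<open>g < H\<close> would contradict \<open>D H < D g\<close>.\<close>
    have ne: "int g * p' - int H * p \<noteq> 0"
    proof
      assume "int g * p' - int H * p = 0"
      then have e: "real g * p' = real H * p"
        by (metis eq_iff_diff_eq_0 of_int_mult of_int_of_nat_eq)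
      have "real g * D H = \<bar>real g * (real H * x) - real g * p'\<bar>"
        unfolding D_def p'_def by (simp add: abs_mult flip: right_diff_distrib)
      also have "\<dots> = \<bar>real H * (real g * x - p)\<bar>"
        using e by (intro arg_cong[of _ _ abs]) (simp add: algebra_simps)
      also have "\<dots> = real H * D g" by (simp add: D_def p_def abs_mult)
      finally have "real g * D H = real H * D g" .
      moreover have "real g * D H \<le> real H * D H"
        using g XH by (intro mult_right_mono) (auto simp: D_def)
      moreover have "real H * D H < real H * D g"
        using H by (intro mult_strict_left_mono) auto
      ultimately show False by linarith
    qed
    then have "1 \<le> \<bar>real_of_int (int g * p' - int H * p)\<bar>" by linarith
    also have "real_of_int (int g * p' - int H * p) = real H * (real g * x - p) - real g * (real H * x - p')"
      by (simp add: algebra_simps)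
    also have "\<bar>\<dots>\<bar> \<le> real H * D g + real g * D H"
      unfolding D_def p_def[symmetric] p'_def[symmetric]
      by (rule order_trans[OF abs_triangle_ineq4]) (simp add: abs_mult)
    also have "\<dots> \<le> real H * D g + real H * D g"
      using g XH H by (intro add_left_mono mult_mono) (auto simp: D_def)
    finally show ?thesis using H by (simp add: field_simps)
  qed
  have "separating x H"
    unfolding separating_def
  proof (intro conjI allI impI)
    fix h p :: int assume h: "0 < h" "h < int H"
    then have "D g \<le> D (nat h)" by (intro H_least) auto
    then show "1 / (2 * real H) \<le> \<bar>real_of_int h * x - p\<bar>"
      using D_le[of "nat h" p] Dg h by simp
  qed (use H in auto)
  then show ?thesis using XH \<open>H \<le> r\<close> r by auto
qed

section \<open>Cubes and cells in the product space\<close>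

abbreviation (input) lborel_PiM :: "'a set \<Rightarrow> ('a \<Rightarrow> real) measure" where
  "lborel_PiM I \<equiv> (\<Pi>\<^sub>M i\<in>I. (lborel :: real measure))"

lemma
  fixes A :: "'a \<Rightarrow> real set"
  assumes I: "finite I" and A: "\<And>i. i \<in> I \<Longrightarrow> A i \<in> fmeasurable lborel"
  shows fmeasurable_PiE_lborel: "PiE I A \<in> fmeasurable (lborel_PiM I)"
    and measure_PiE_lborel: "measure (lborel_PiM I) (PiE I A) = (\<Prod>i\<in>I. measure lborel (A i))"
proof -
  have sA: "A i \<in> sets borel" if "i \<in> I" for i
    using fmeasurableD[OF A[OF that]] by simp
  interpret product_sigma_finite "\<lambda>_::'a. lborel :: real measure" ..
  have "emeasure (lborel_PiM I) (PiE I A) = (\<Prod>i\<in>I. emeasure lborel (A i))"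
    using I sA by (intro emeasure_PiM) simp_all
  also have "\<dots> = (\<Prod>i\<in>I. ennreal (measure lborel (A i)))"
    using A by (intro prod.cong refl emeasure_eq_measure2)
  also have "\<dots> = ennreal (\<Prod>i\<in>I. measure lborel (A i))"
    by (rule prod_ennreal) simp
  finally have *: "emeasure (lborel_PiM I) (PiE I A) = ennreal (\<Prod>i\<in>I. measure lborel (A i))" .
  show "PiE I A \<in> fmeasurable (lborel_PiM I)"
    using I * sA by (intro fmeasurableI sets_PiM_I_finite) simp_all
  show "measure (lborel_PiM I) (PiE I A) = (\<Prod>i\<in>I. measure lborel (A i))"
    using * by (simp add: measure_def prod_nonneg)
qed

text \<open>The set is covered by intervals of length \<open>2 * \<kappa> / q\<close> about
  fractions \<open>p / q\<close>, at most \<open>q * l + 3\<close> of which come into play. The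
  boundary term \<open>3 / q\<close> matters only when \<open>q\<close> is small compared with
  \<open>1 / l\<close>.\<close>

lemma measure_near_integer:
  fixes q \<kappa> u l :: real
  assumes q: "q > 0" and \<kappa>: "0 < \<kappa>" "\<kappa> \<le> 1" and l: "0 \<le> l"
  defines "S \<equiv> {y\<in>{u..<u + l}. \<exists>p::int. \<bar>q * y - p\<bar> < \<kappa>}"
  shows "S \<in> fmeasurable lborel" and "measure lborel S \<le> 2 * \<kappa> * (l + 3 / q)"
proof -
  define P where "P = {\<lceil>q * u - \<kappa>\<rceil>..\<lfloor>q * (u + l) + \<kappa>\<rfloor>}"
  define B where "B p = {(real_of_int p - \<kappa>) / q<..<(real_of_int p + \<kappa>) / q}" for p
  have B_iff: "y \<in> B p \<longleftrightarrow> \<bar>q * y - p\<bar> < \<kappa>" for y p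
    using q by (auto simp: B_def field_simps abs_less_iff)
  have "S = {u..<u + l} \<inter> (\<Union>p. B p)"
    by (auto simp: S_def B_iff)
  moreover have "B p \<in> sets lborel" for p by (simp add: B_def)
  ultimately have S: "S \<in> sets lborel" by auto
  show "S \<in> fmeasurable lborel"
    by (rule fmeasurableI2[of "{u..u + l}"]) (use S l in \<open>auto simp: S_def fmeasurable_def emeasure_lborel_Icc_eq\<close>)
  have sub: "S \<subseteq> (\<Union>p\<in>P. B p)"
  proof
    fix y assume y: "y \<in> S"
    then obtain p where p: "y \<in> B p" by (auto simp: S_def B_iff)
    have "q * u \<le> q * y" "q * y \<le> q * (u + l)"
      using y q by (auto simp: S_def)
    then have "q * u - \<kappa> \<le> p" "p \<le> q * (u + l) + \<kappa>"
      using p unfolding B_iff by linarith+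
    then have "p \<in> P" by (simp add: P_def ceiling_le_iff le_floor_iff)
    then show "y \<in> (\<Union>p\<in>P. B p)" using p by blast
  qed
  have fB: "B p \<in> fmeasurable lborel" for p
    using q \<kappa> by (simp add: B_def fmeasurable_def emeasure_lborel_Ioo divide_right_mono)
  have "measure lborel S \<le> measure lborel (\<Union>p\<in>P. B p)"
    using S sub fB by (intro measure_mono_fmeasurable fmeasurable.finite_UN) (auto simp: P_def)
  also have "\<dots> \<le> (\<Sum>p\<in>P. measure lborel (B p))"
    using fB by (intro measure_UNION_le) (auto simp: P_def B_def)
  also have "\<dots> = real (card P) * (2 * \<kappa> / q)"
    using q \<kappa> by (simp add: B_def field_simps)
  also have "\<dots> \<le> (q * l + 3) * (2 * \<kappa> / q)"
  proof (intro mult_right_mono)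
    have "real_of_int \<lfloor>q * (u + l) + \<kappa>\<rfloor> - real_of_int \<lceil>q * u - \<kappa>\<rceil> \<le> q * l + 2 * \<kappa>"
      by (simp add: algebra_simps) linarith
    moreover have "0 \<le> q * l" using q l by simp
    ultimately show "real (card P) \<le> q * l + 3"
      using \<kappa> by (auto simp: P_def of_nat_nat split: nat_diff_split)
  qed (use q \<kappa> in auto)
  also have "\<dots> = 2 * \<kappa> * (l + 3 / q)" using q by (simp add: field_simps)
  finally show "measure lborel S \<le> 2 * \<kappa> * (l + 3 / q)" .
qed

text \<open>Integrate \<open>2 L F 1\<^sub>D \<le> F\<^sup>2 + L\<^sup>2 1\<^sub>D\<close> for \<open>F\<close> the sum of the indicators of the \<open>b s\<close>.\<close>

lemma sum_measure_Int_le: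
  fixes L :: real
  assumes S: "finite S" and b: "\<And>s. s \<in> S \<Longrightarrow> b s \<in> fmeasurable M" and D: "D \<in> fmeasurable M"
  shows "2 * L * (\<Sum>s\<in>S. measure M (b s \<inter> D))
           \<le> (\<Sum>s\<in>S. \<Sum>r\<in>S. measure M (b s \<inter> b r)) + L\<^sup>2 * measure M D"
proof -
  have int: "integrable M (indicator A :: _ \<Rightarrow> real)" if "A \<in> fmeasurable M" for A
    using that by (auto simp: fmeasurable_def intro: integrable_real_indicator)
  have m: "integral\<^sup>L M (indicator A :: _ \<Rightarrow> real) = measure M A" if "A \<in> fmeasurable M" for A
    using that by (simp add: measure_eq_emeasure_eq_ennreal sets.Int_space_eq2 fmeasurableD)
  define F where "F = (\<lambda>y. \<Sum>s\<in>S. indicator (b s) y :: real)"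
  have I1: "2 * L * (\<Sum>s\<in>S. measure M (b s \<inter> D)) = integral\<^sup>L M (\<lambda>y. 2 * L * (\<Sum>s\<in>S. indicator (b s \<inter> D) y))"
  proof -
    have "(\<Sum>s\<in>S. measure M (b s \<inter> D)) = integral\<^sup>L M (\<lambda>y. \<Sum>s\<in>S. indicator (b s \<inter> D) y)"
      using b D by (subst Bochner_Integration.integral_sum) (auto intro!: int simp: m fmeasurable.Int)
    then show ?thesis by simp
  qed
  have I2: "(\<Sum>s\<in>S. \<Sum>r\<in>S. measure M (b s \<inter> b r)) + L\<^sup>2 * measure M D
      = integral\<^sup>L M (\<lambda>y. (\<Sum>s\<in>S. \<Sum>r\<in>S. indicator (b s \<inter> b r) y) + L\<^sup>2 * indicator D y)"
  proof -
    have J: "integrable M (\<lambda>y. \<Sum>r\<in>S. indicator (b s \<inter> b r) y :: real)" if "s \<in> S" for s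
      using b that by (intro Bochner_Integration.integrable_sum int) auto
    have "integral\<^sup>L M (\<lambda>y. \<Sum>s\<in>S. \<Sum>r\<in>S. indicator (b s \<inter> b r) y :: real)
        = (\<Sum>s\<in>S. integral\<^sup>L M (\<lambda>y. \<Sum>r\<in>S. indicator (b s \<inter> b r) y :: real))"
      using J by (rule Bochner_Integration.integral_sum)
    also have "\<dots> = (\<Sum>s\<in>S. \<Sum>r\<in>S. measure M (b s \<inter> b r))"
    proof (intro sum.cong refl)
      fix s assume "s \<in> S"
      then show "integral\<^sup>L M (\<lambda>y. \<Sum>r\<in>S. indicator (b s \<inter> b r) y) = (\<Sum>r\<in>S. measure M (b s \<inter> b r))"
        using b by (subst Bochner_Integration.integral_sum) (auto intro!: int simp: m fmeasurable.Int)
    qed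
    finally have "integral\<^sup>L M (\<lambda>y. \<Sum>s\<in>S. \<Sum>r\<in>S. indicator (b s \<inter> b r) y)
        = (\<Sum>s\<in>S. \<Sum>r\<in>S. measure M (b s \<inter> b r))" .
    moreover have "integral\<^sup>L M (\<lambda>y. L\<^sup>2 * indicator D y) = L\<^sup>2 * measure M D"
      using D by (simp add: m)
    ultimately show ?thesis
      using J D by (subst Bochner_Integration.integral_add)
        (auto intro!: int Bochner_Integration.integrable_sum integrable_mult_right)
  qed
  show ?thesis
    unfolding I1 I2
  proof (rule integral_mono)
    show "integrable M (\<lambda>y. 2 * L * (\<Sum>s\<in>S. indicator (b s \<inter> D) y))"
      using b D by (intro integrable_mult_right Bochner_Integration.integrable_sum int) auto
    show "integrable M (\<lambda>y. (\<Sum>s\<in>S. \<Sum>r\<in>S. indicator (b s \<inter> b r) y) + L\<^sup>2 * indicator D y)"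
      using b D by (intro Bochner_Integration.integrable_add integrable_mult_right Bochner_Integration.integrable_sum int) auto
    fix y assume "y \<in> space M"
    have 1: "(\<Sum>s\<in>S. indicator (b s \<inter> D) y) = F y * indicator D y"
      by (simp add: F_def indicator_inter_arith sum_distrib_right)
    have 2: "(\<Sum>s\<in>S. \<Sum>r\<in>S. indicator (b s \<inter> b r) y) = F y * F y"
      by (simp add: F_def indicator_inter_arith sum_product)
    have "0 \<le> (F y - L * indicator D y)\<^sup>2" by simp
    then have "2 * L * (F y * indicator D y) \<le> F y * F y + L\<^sup>2 * (indicator D y * indicator D y)"
      by (simp add: power2_eq_square algebra_simps)
    moreover have "indicator D y * indicator D y = (indicator D y :: real)"
      by (simp add: indicator_def)
    ultimately show "2 * L * (\<Sum>s\<in>S. indicator (b s \<inter> D) y)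
        \<le> (\<Sum>s\<in>S. \<Sum>r\<in>S. indicator (b s \<inter> b r) y) + L\<^sup>2 * indicator D y"
      unfolding 1 2 by simp
  qed
qed

section \<open>Grid cells, cubes and the nesting of dyadic grids\<close>

definition cell :: "'a set \<Rightarrow> real \<Rightarrow> ('a \<Rightarrow> int) \<Rightarrow> ('a \<Rightarrow> real) set" where
  "cell I s j = (\<Pi>\<^sub>E i\<in>I. {j i / s..<(j i + 1) / s})"

definition cell_index :: "'a set \<Rightarrow> real \<Rightarrow> ('a \<Rightarrow> real) \<Rightarrow> 'a \<Rightarrow> int" where
  "cell_index I s y = (\<lambda>i\<in>I. \<lfloor>s * y i\<rfloor>)"

lemma mem_cell_iff:
  assumes "s > 0"
  shows "y \<in> cell I s j \<longleftrightarrow> y \<in> extensional I \<and> (\<forall>i\<in>I. \<lfloor>s * y i\<rfloor> = j i)"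
  using assms by (auto simp: cell_def PiE_iff floor_eq_iff field_simps)

lemma mem_cell_cell_index:
  assumes "s > 0" "y \<in> extensional I"
  shows "y \<in> cell I s (cell_index I s y)"
  using assms by (simp add: mem_cell_iff cell_index_def)

lemma cell_index_eq:
  assumes "s > 0" "y \<in> cell I s j" "j \<in> extensional I"
  shows "cell_index I s y = j"
  using assms by (auto simp: mem_cell_iff cell_index_def extensional_def)

lemma
  assumes "finite I" "s > 0"
  shows fmeasurable_cell: "cell I s j \<in> fmeasurable (lborel_PiM I)"
    and measure_cell: "measure (lborel_PiM I) (cell I s j) = (1 / s) ^ card I"
proof -
  have *: "{j i / s..<(j i + 1) / s} \<in> fmeasurable lborel" for i
    using assms by (simp add: fmeasurable_def divide_right_mono)
  show "cell I s j \<in> fmeasurable (lborel_PiM I)"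
    unfolding cell_def using assms * by (intro fmeasurable_PiE_lborel) auto
  show "measure (lborel_PiM I) (cell I s j) = (1 / s) ^ card I"
    unfolding cell_def using assms *
    by (subst measure_PiE_lborel) (auto simp: divide_right_mono simp flip: diff_divide_distrib)
qed

definition open_cube :: "'a set \<Rightarrow> real \<Rightarrow> ('a \<Rightarrow> real) \<Rightarrow> ('a \<Rightarrow> real) set" where
  "open_cube I r z = (\<Pi>\<^sub>E i\<in>I. {z i - r<..<z i + r})"

lemma
  assumes "finite I" "r \<ge> 0"
  shows fmeasurable_open_cube: "open_cube I r z \<in> fmeasurable (lborel_PiM I)"
    and measure_open_cube: "measure (lborel_PiM I) (open_cube I r z) = (2 * r) ^ card I"
proof -
  have *: "{z i - r<..<z i + r} \<in> fmeasurable lborel" for i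
    using assms by (simp add: fmeasurable_def)
  show "open_cube I r z \<in> fmeasurable (lborel_PiM I)"
    unfolding open_cube_def using assms * by (intro fmeasurable_PiE_lborel) auto
  show "measure (lborel_PiM I) (open_cube I r z) = (2 * r) ^ card I"
    unfolding open_cube_def using assms * by (subst measure_PiE_lborel) auto
qed

text \<open>Half-open with integral end points, so that it is a union of unit cells and therefore of
  dyadic cells.\<close>

definition big_cube :: "'a set \<Rightarrow> nat \<Rightarrow> ('a \<Rightarrow> real) set" where
  "big_cube I R = (\<Pi>\<^sub>E i\<in>I. {- real R..<real R})"

lemma fmeasurable_big_cube:
  assumes "finite I"
  shows "big_cube I R \<in> fmeasurable (lborel_PiM I)"
  unfolding big_cube_def using assms by (intro fmeasurable_PiE_lborel) (auto simp: fmeasurable_def)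

lemma cell_index_big_cube:
  assumes "y \<in> big_cube I R" "s > 0"
  shows "cell_index I s y \<in> (\<Pi>\<^sub>E i\<in>I. {- \<lceil>R * s\<rceil>..<\<lceil>R * s\<rceil>})"
proof -
  have "- \<lceil>R * s\<rceil> \<le> \<lfloor>s * y i\<rfloor> \<and> \<lfloor>s * y i\<rfloor> < \<lceil>R * s\<rceil>" if "i \<in> I" for i
  proof -
    have y: "- real R \<le> y i" "y i < R" using assms that by (auto simp: big_cube_def PiE_iff)
    have "s * (- real R) \<le> s * y i" "s * y i < s * R"
      using y assms(2) by (intro mult_left_mono mult_strict_left_mono; simp)+
    then show ?thesis
      by (simp add: le_floor_iff floor_less_iff mult.commute) (smt (verit) le_of_int_ceiling)
  qed
  then show ?thesis by (auto simp: cell_index_def)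
qed

lemma finite_cell_index_big_cube:
  assumes "finite I" "s > 0" "A \<subseteq> big_cube I R"
  shows "finite (cell_index I s ` A)"
proof (rule finite_subset)
  show "cell_index I s ` A \<subseteq> (\<Pi>\<^sub>E i\<in>I. {- \<lceil>R * s\<rceil>..<\<lceil>R * s\<rceil>})"
    using assms cell_index_big_cube by fast
qed (use assms in \<open>auto intro: finite_PiE\<close>)

text \<open>Dyadic grids are nested: a coarse floor is the fine floor divided by a power of
  2.\<close>

lemma cell_index_2_power_mono:
  assumes "cell_index I (2 ^ n) y = cell_index I (2 ^ n) z" "m \<le> n"
  shows "cell_index I (2 ^ m) y = cell_index I (2 ^ m) z"
proof -
  have "\<lfloor>2 ^ m * y i\<rfloor> = \<lfloor>2 ^ n * y i\<rfloor> div 2 ^ (n - m)" for y :: "'a \<Rightarrow> real" and i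
  proof -
    have "\<lfloor>2 ^ n * y i / real_of_int (2 ^ (n - m))\<rfloor> = \<lfloor>2 ^ n * y i\<rfloor> div 2 ^ (n - m)"
      by (rule floor_divide_real_eq_div) simp
    moreover have "2 ^ n * y i / real_of_int (2 ^ (n - m)) = 2 ^ m * y i"
    proof -
      have "(2::real) ^ n = 2 ^ m * 2 ^ (n - m)" using assms(2) by (simp flip: power_add)
      then show ?thesis by simp
    qed
    ultimately show ?thesis by simp
  qed
  moreover have "\<lfloor>2 ^ n * y i\<rfloor> = \<lfloor>2 ^ n * z i\<rfloor>" if "i \<in> I" for i
    using fun_cong[OF assms(1), of i] that by (simp add: cell_index_def)
  ultimately show ?thesis by (auto simp: cell_index_def restrict_def)
qed

lemma cell_index_near:
  assumes "cell_index I s y = cell_index I s z" "i \<in> I" "s > 0"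
  shows "\<bar>y i - z i\<bar> < 1 / s"
proof -
  have "\<lfloor>s * y i\<rfloor> = \<lfloor>s * z i\<rfloor>"
    using fun_cong[OF assms(1), of i] assms(2) by (simp add: cell_index_def)
  then have "\<bar>s * y i - s * z i\<bar> < 1" by linarith
  then have "s * \<bar>y i - z i\<bar> < 1" using assms(3) by (simp add: abs_mult flip: right_diff_distrib)
  then show ?thesis using assms(3) by (simp add: field_simps)
qed

text \<open>Membership in the big cube depends only on the integer parts of the coordinates, that
  is, on the cell index at level 0.\<close>

lemma cell_subset_big_cube:
  fixes n :: nat
  assumes "j \<in> cell_index I (2 ^ n) ` big_cube I R"
  shows "cell I (2 ^ n) j \<subseteq> big_cube I R"
proof
  fix z assume z: "z \<in> cell I (2 ^ n) j"
  obtain y where y: "y \<in> big_cube I R" "j = cell_index I (2 ^ n) y" using assms by auto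
  have "\<lfloor>z i\<rfloor> = \<lfloor>y i\<rfloor>" if "i \<in> I" for i
  proof -
    have "cell_index I (2 ^ n) z = cell_index I (2 ^ n) y"
      using z y(2) by (intro cell_index_eq) (auto simp: cell_index_def)
    then have "cell_index I (2 ^ 0) z = cell_index I (2 ^ 0) y"
      by (rule cell_index_2_power_mono) simp
    from fun_cong[OF this, of i] show ?thesis using that by (simp add: cell_index_def)
  qed
  moreover have "- real R \<le> y i" "y i < R" if "i \<in> I" for i
    using y that by (auto simp: big_cube_def PiE_iff)
  ultimately have "- int R \<le> \<lfloor>z i\<rfloor>" "\<lfloor>z i\<rfloor> < int R" if "i \<in> I" for i
    using that by (force simp: le_floor_iff floor_less_iff)+
  then show "z \<in> big_cube I R"
    using z unfolding mem_cell_iff[OF zero_less_power[OF zero_less_numeral]] big_cube_def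
    by (auto simp: PiE_iff le_floor_iff floor_less_iff)
qed

section \<open>A second moment criterion\<close>

text \<open>With truncated subtraction the exponent is the distance of \<open>u\<close> and
  \<open>t\<close>; each side of \<open>t\<close> contributes a geometric series of sum at most
  2.\<close>

lemma sum_half_power_dist_le:
  fixes t :: nat
  assumes "finite F"
  shows "(\<Sum>u\<in>F. (1/2::real) ^ ((u - t) + (t - u))) \<le> 4"
proof -
  have geo: "(\<Sum>u\<in>A. (1/2::real) ^ u) \<le> 2" if "finite A" for A :: "nat set"
    using sum_le_suminf[of "\<lambda>u. (1/2::real) ^ u" A] that
    by (simp add: suminf_geometric)
  let ?f = "\<lambda>u. (1/2::real) ^ ((u - t) + (t - u))"
  have "sum ?f (F \<inter> {t..}) = (\<Sum>u\<in>(\<lambda>u. u - t) ` (F \<inter> {t..}). (1/2) ^ u)"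
    by (subst sum.reindex) (auto simp: inj_on_def)
  then have 1: "sum ?f (F \<inter> {t..}) \<le> 2" using geo assms by simp
  have "sum ?f (F \<inter> {..t}) = (\<Sum>u\<in>(\<lambda>u. t - u) ` (F \<inter> {..t}). (1/2) ^ u)"
    by (subst sum.reindex) (auto simp: inj_on_def)
  then have 2: "sum ?f (F \<inter> {..t}) \<le> 2" using geo assms by simp
  have "sum ?f F \<le> sum ?f (F \<inter> {t..}) + sum ?f (F \<inter> {..t})"
  proof -
    have "F = (F \<inter> {t..}) \<union> (F \<inter> {..t})" by auto
    then have "sum ?f F = sum ?f ((F \<inter> {t..}) \<union> (F \<inter> {..t}))" by simp
    also have "\<dots> \<le> sum ?f (F \<inter> {t..}) + sum ?f (F \<inter> {..t})"
      using assms by (subst sum_Un) (auto intro!: sum_nonneg)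
    finally show ?thesis .
  qed
  with 1 2 show ?thesis by linarith
qed

text \<open>
  If the set had positive measure, then so would every dyadic neighbourhood of it, which the cubes
  meet in the expected proportion; by the second moment bound they cannot all do so within the
  small difference of the neighbourhood and the set.
\<close>

lemma limsup_open_cubes_null:
  fixes I :: "'a set" and R m :: nat and T :: "nat set" and J :: "nat \<Rightarrow> 'b set"
    and z :: "nat \<Rightarrow> 'b \<Rightarrow> 'a \<Rightarrow> real" and r w :: "nat \<Rightarrow> real" and c K :: real
  defines "M \<equiv> lborel_PiM I"
    and "b \<equiv> \<lambda>t i. open_cube I (r t) (z t i)"
  assumes I: "finite I" and c: "c > 0" and K: "K \<ge> 0"
    and J: "\<And>t. t \<in> T \<Longrightarrow> finite (J t)"
    and r: "\<And>t. t \<in> T \<Longrightarrow> r t \<ge> 0"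
    and w: "\<And>t. t \<in> T \<Longrightarrow> w t \<ge> 0"
    and w_div: "\<And>B m. \<exists>F. finite F \<and> F \<subseteq> T \<inter> {m..} \<and> B \<le> sum w F"
    and lower: "\<And>n. \<exists>t0. \<forall>t\<in>T. t \<ge> t0 \<longrightarrow> (\<forall>j\<in>cell_index I (2 ^ n) ` big_cube I R.
        c * w t * measure M (cell I (2 ^ n) j) \<le> (\<Sum>i\<in>J t. measure M (b t i \<inter> cell I (2 ^ n) j)))"
    and upper: "\<And>t u. t \<in> T \<Longrightarrow> u \<in> T \<Longrightarrow> t \<le> u \<Longrightarrow>
        (\<Sum>i\<in>J t. \<Sum>l\<in>J u. measure M (b t i \<inter> b u l)) \<le> K * (w t * w u + (1/2) ^ (u - t) * w u)"
  shows "{y\<in>big_cube I R. \<forall>t\<in>T. t \<ge> m \<longrightarrow> (\<forall>i\<in>J t. y \<notin> b t i)} \<in> null_sets M"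
proof -
  define C where "C = {y\<in>big_cube I R. \<forall>t\<in>T. t \<ge> m \<longrightarrow> (\<forall>i\<in>J t. y \<notin> b t i)}"
  have b_fm: "b t i \<in> fmeasurable M" if "t \<in> T" for t i
    unfolding b_def M_def using I r that by (intro fmeasurable_open_cube) auto
  have C_eq: "C = big_cube I R - (\<Union>t\<in>T \<inter> {m..}. \<Union>i\<in>J t. b t i)"
    by (auto simp: C_def)
  have "(\<Union>t\<in>T \<inter> {m..}. \<Union>i\<in>J t. b t i) \<in> sets M"
    using b_fm J by (intro sets.countable_UN' sets.finite_UN) (auto simp: fmeasurable_def)
  then have C_fm: "C \<in> fmeasurable M"
    unfolding C_eq using fmeasurable_big_cube[OF I] by (intro fmeasurable_Diff) (auto simp: M_def)
  have C_ext: "y \<in> extensional I" if "y \<in> C" for y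
    using that by (auto simp: C_def big_cube_def PiE_iff)
  \<comment> \<open>\<open>V n\<close> consists of the dyadic cells of side \<open>1 / 2 ^ n\<close>
    that meet \<open>C\<close>. It decreases to \<open>C\<close>, because \<open>C\<close> is what
    remains of the big cube after removing open cubes.\<close>
  define V where "V n = (\<Union>j\<in>cell_index I (2 ^ n) ` C. cell I (2 ^ n) j)" for n :: nat
  have V_iff: "y \<in> V n \<longleftrightarrow> y \<in> extensional I \<and> (\<exists>y'\<in>C. cell_index I (2 ^ n) y = cell_index I (2 ^ n) y')" for y n
    by (auto simp: V_def mem_cell_iff cell_index_def restrict_def fun_eq_iff)
  have finC: "finite (cell_index I (2 ^ n) ` C)" for n :: nat
    using I by (intro finite_cell_index_big_cube[where R=R]) (auto simp: C_def)
  have cell_fm: "cell I (2 ^ n) j \<in> fmeasurable M" for n :: nat and j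
    unfolding M_def using I by (intro fmeasurable_cell) auto
  have V_fm: "V n \<in> fmeasurable M" for n
    unfolding V_def using finC cell_fm by (intro fmeasurable.finite_UN) auto
  have CV: "C \<subseteq> V n" for n
    using C_ext by (auto simp: V_iff)
  have V_big: "V n \<subseteq> big_cube I R" for n
    using cell_subset_big_cube[of _ I n R] by (fastforce simp: V_def C_def)
  have V_dec: "decseq V"
    unfolding decseq_def using cell_index_2_power_mono by (force simp: V_iff)
  have V_Int: "(\<Inter>n. V n) = C"
  proof (intro equalityI subsetI)
    fix y assume y: "y \<in> (\<Inter>n. V n)"
    show "y \<in> C"
    proof (rule ccontr)
      assume "y \<notin> C"
      moreover have "y \<in> big_cube I R" using y V_big by blast
      ultimately obtain t i where ti: "t \<in> T" "t \<ge> m" "i \<in> J t" "y \<in> b t i" by (auto simp: C_def)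
      define e where "e = (\<lambda>l. r t - \<bar>y l - z t i l\<bar>)"
      have e: "e l > 0" if "l \<in> I" for l
        using ti(4) that by (auto simp: b_def open_cube_def PiE_iff e_def abs_less_iff field_simps dest!: bspec)
      have "\<forall>\<^sub>F n in sequentially. \<forall>l\<in>I. (1/2::real) ^ n < e l"
      proof (intro eventually_ball_finite I ballI)
        fix l assume "l \<in> I"
        have "(\<lambda>n. (1/2::real) ^ n) \<longlonglongrightarrow> 0" by (rule LIMSEQ_power_zero) simp
        then show "\<forall>\<^sub>F n in sequentially. (1/2::real) ^ n < e l"
          using e[OF \<open>l \<in> I\<close>] by (rule order_tendstoD(2))
      qed
      then obtain n :: nat where n: "\<forall>l\<in>I. (1/2::real) ^ n < e l"
        by (auto simp: eventually_sequentially)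
      obtain y' where y': "y' \<in> C" "cell_index I (2 ^ n) y = cell_index I (2 ^ n) y'"
        using y V_iff by blast
      have "y' \<in> b t i"
        unfolding b_def open_cube_def PiE_iff
      proof (intro conjI ballI)
        show "y' \<in> extensional I" using C_ext y' by blast
        fix l assume l: "l \<in> I"
        have "\<bar>y l - y' l\<bar> < (1/2) ^ n"
          using cell_index_near[OF y'(2) l] by (simp add: power_one_over)
        moreover have "(1/2) ^ n < r t - \<bar>y l - z t i l\<bar>" using n l by (auto simp: e_def)
        ultimately show "y' l \<in> {z t i l - r t<..<z t i l + r t}" by auto
      qed
      then show False using y'(1) ti by (auto simp: C_def)
    qed
  qed (use CV in blast)
  have V_lim: "(\<lambda>n. measure M (V n)) \<longlonglongrightarrow> measure M C"
    using Lim_measure_decseq[of V M] V_fm V_dec unfolding V_Int by (auto simp: fmeasurable_def image_subset_iff less_top)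
  define \<gamma> where "\<gamma> = measure M C"
  \<comment> \<open>This is \<open>sum_measure_Int_le\<close> with \<open>L = a * W\<close>, divided
    by \<open>W\<^sup>2\<close>. As \<open>n\<close> grows the last term vanishes for each fixed
    \<open>a\<close>.\<close>
  have key: "2 * a * c * \<gamma> \<le> 9 * K + a\<^sup>2 * (measure M (V n) - \<gamma>)" if a: "a \<ge> 0" for n and a :: real
  proof -
    obtain t0 where t0: "\<forall>t\<in>T. t \<ge> t0 \<longrightarrow> (\<forall>j\<in>cell_index I (2 ^ n) ` big_cube I R.
        c * w t * measure M (cell I (2 ^ n) j) \<le> (\<Sum>i\<in>J t. measure M (b t i \<inter> cell I (2 ^ n) j)))"
      using lower[of n] by (rule exE)
    obtain F where F: "finite F" "F \<subseteq> T \<inter> {max m t0..}" "1 \<le> sum w F"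
      using w_div[of "max m t0" 1] by (elim exE conjE)
    have FT: "t \<in> T" "t \<ge> m" "t \<ge> t0" if "t \<in> F" for t
      using F(2) that by auto
    define W where "W = sum w F"
    define S where "S = Sigma F J"
    define B where "B s = b (fst s) (snd s)" for s
    have W: "W \<ge> 1" using F by (simp add: W_def)
    have finS: "finite S" unfolding S_def using F J FT by (intro finite_SigmaI) auto
    have B_fm: "B s \<in> fmeasurable M" if "s \<in> S" for s
      using that FT b_fm by (auto simp: S_def B_def)
    have sumS: "(\<Sum>s\<in>S. f (fst s) (snd s)) = (\<Sum>t\<in>F. \<Sum>i\<in>J t. f t i)" for f :: "nat \<Rightarrow> 'b \<Rightarrow> real"
      unfolding S_def using F J FT by (subst sum.Sigma) (auto simp: case_prod_beta)
    have V_C: "measure M (V n - C) = measure M (V n) - \<gamma>"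
      unfolding \<gamma>_def using CV V_fm C_fm by (intro measurable_measure_Diff) (auto dest: fmeasurableD)
    \<comment> \<open>The cubes used here miss \<open>C\<close>, so whatever they cover of
      \<open>V n\<close> lies in \<open>V n - C\<close>, which is small for large
      \<open>n\<close>.\<close>
    have lo: "c * W * \<gamma> \<le> (\<Sum>s\<in>S. measure M (B s \<inter> (V n - C)))"
    proof -
      have t: "c * w t * \<gamma> \<le> (\<Sum>i\<in>J t. measure M (b t i \<inter> (V n - C)))" if "t \<in> F" for t
      proof -
        have disj: "pairwise (\<lambda>j j'. disjnt (A \<inter> cell I (2 ^ n) j) (A \<inter> cell I (2 ^ n) j')) (cell_index I (2 ^ n) ` C)" for A
        proof (rule pairwiseI)
          fix j j' assume jj: "j \<in> cell_index I (2 ^ n) ` C" "j' \<in> cell_index I (2 ^ n) ` C" "j \<noteq> j'"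
          then have "j \<in> extensional I" "j' \<in> extensional I" by (auto simp: cell_index_def)
          then have "\<not> (y \<in> cell I (2 ^ n) j \<and> y \<in> cell I (2 ^ n) j')" for y
            using cell_index_eq[of "2 ^ n" y I j] cell_index_eq[of "2 ^ n" y I j'] jj(3) by auto
          then show "disjnt (A \<inter> cell I (2 ^ n) j) (A \<inter> cell I (2 ^ n) j')"
            by (auto simp: disjnt_def)
        qed
        have VA: "measure M (A \<inter> V n) = (\<Sum>j\<in>cell_index I (2 ^ n) ` C. measure M (A \<inter> cell I (2 ^ n) j))"
          if "A \<in> sets M" for A
        proof -
          have "A \<inter> V n = (\<Union>j\<in>cell_index I (2 ^ n) ` C. A \<inter> cell I (2 ^ n) j)"
            by (auto simp: V_def)
          moreover have "A \<inter> cell I (2 ^ n) j \<in> fmeasurable M" for j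
            using fmeasurable_Int_fmeasurable[OF cell_fm that] by (simp add: Int_commute)
          ultimately show ?thesis
            using measure_UNION'[OF finC _ disj, of A M] by simp
        qed
        have "c * w t * \<gamma> \<le> c * w t * measure M (V n)"
          unfolding \<gamma>_def using CV V_fm C_fm c w FT[OF that]
          by (intro mult_left_mono measure_mono_fmeasurable) (auto dest: fmeasurableD)
        also have "measure M (V n) = measure M (space M \<inter> V n)"
          using V_fm[of n] by (simp add: fmeasurableD sets.Int_space_eq1)
        also have "\<dots> = (\<Sum>j\<in>cell_index I (2 ^ n) ` C. measure M (cell I (2 ^ n) j))"
          using cell_fm by (subst VA) (auto simp: fmeasurableD sets.Int_space_eq1)
        also have "c * w t * \<dots> = (\<Sum>j\<in>cell_index I (2 ^ n) ` C. c * w t * measure M (cell I (2 ^ n) j))"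
          by (rule sum_distrib_left)
        also have "\<dots> \<le> (\<Sum>j\<in>cell_index I (2 ^ n) ` C. \<Sum>i\<in>J t. measure M (b t i \<inter> cell I (2 ^ n) j))"
          using FT[OF that] by (intro sum_mono t0[rule_format]) (auto simp: C_def)
        also have "\<dots> = (\<Sum>i\<in>J t. \<Sum>j\<in>cell_index I (2 ^ n) ` C. measure M (b t i \<inter> cell I (2 ^ n) j))"
          by (rule sum.swap)
        also have "\<dots> = (\<Sum>i\<in>J t. measure M (b t i \<inter> V n))"
          using b_fm FT[OF that] by (intro sum.cong refl VA[symmetric]) (auto dest: fmeasurableD)
        also have "\<dots> = (\<Sum>i\<in>J t. measure M (b t i \<inter> (V n - C)))"
        proof (intro sum.cong refl arg_cong[of _ _ "measure M"])
          fix i assume "i \<in> J t"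
          then have "b t i \<inter> C = {}" using FT[OF that] by (auto simp: C_def)
          then show "b t i \<inter> V n = b t i \<inter> (V n - C)" by auto
        qed
        finally show ?thesis .
      qed
      have "c * W * \<gamma> = (\<Sum>t\<in>F. c * w t * \<gamma>)"
        by (simp add: W_def sum_distrib_left sum_distrib_right)
      also have "\<dots> \<le> (\<Sum>t\<in>F. \<Sum>i\<in>J t. measure M (b t i \<inter> (V n - C)))"
        by (intro sum_mono t)
      also have "\<dots> = (\<Sum>s\<in>S. measure M (B s \<inter> (V n - C)))"
        unfolding B_def by (rule sumS[symmetric])
      finally show ?thesis .
    qed
    \<comment> \<open>The constant is 1 + 4 + 4: the products give \<open>W\<^sup>2\<close>, the two
      geometric sums at most \<open>4 * W\<close> each, and \<open>W \<le> W\<^sup>2\<close> because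
      \<open>F\<close> was chosen with weight at least 1.\<close>
    have up: "(\<Sum>s\<in>S. \<Sum>s'\<in>S. measure M (B s \<inter> B s')) \<le> 9 * K * W\<^sup>2"
    proof -
      define G where "G t u = (\<Sum>i\<in>J t. \<Sum>l\<in>J u. measure M (b t i \<inter> b u l))" for t u
      have G_sym: "G t u = G u t" for t u
        unfolding G_def by (subst sum.swap) (simp add: Int_commute)
      \<comment> \<open>Replacing the weight of the later index by \<open>w t + w u\<close> makes
        the bound symmetric, hence valid for both orders of \<open>t\<close> and
        \<open>u\<close>.\<close>
      have G: "G t u \<le> K * (w t * w u + (1/2) ^ ((u - t) + (t - u)) * (w t + w u))" if "t \<in> F" "u \<in> F" for t u
      proof -
        have *: "G t u \<le> K * (w t * w u + (1/2) ^ ((u - t) + (t - u)) * (w t + w u))"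
          if "t \<in> F" "u \<in> F" "t \<le> u" for t u
        proof -
          have "G t u \<le> K * (w t * w u + (1/2) ^ (u - t) * w u)"
            unfolding G_def using that FT by (intro upper) auto
          also have "\<dots> \<le> K * (w t * w u + (1/2) ^ ((u - t) + (t - u)) * (w t + w u))"
            using that K w FT by (intro mult_left_mono add_left_mono) auto
          finally show ?thesis .
        qed
        show ?thesis
          using *[of t u] *[of u t] that by (cases "t \<le> u") (auto simp: G_sym[of t u] ac_simps)
      qed
      have half: "(\<Sum>t\<in>F. \<Sum>u\<in>F. (1/2) ^ ((u - t) + (t - u)) * w t) \<le> 4 * W"
      proof -
        have "(\<Sum>u\<in>F. (1/2) ^ ((u - t) + (t - u)) * w t) \<le> 4 * w t" if "t \<in> F" for t
          using sum_half_power_dist_le[OF F(1), of t] w FT[OF that]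
          by (simp add: mult_right_mono flip: sum_distrib_right)
        then have "(\<Sum>t\<in>F. \<Sum>u\<in>F. (1/2) ^ ((u - t) + (t - u)) * w t) \<le> (\<Sum>t\<in>F. 4 * w t)"
          by (intro sum_mono)
        then show ?thesis by (simp add: W_def sum_distrib_left)
      qed
      have half': "(\<Sum>t\<in>F. \<Sum>u\<in>F. (1/2) ^ ((u - t) + (t - u)) * w u) \<le> 4 * W"
        using half by (subst sum.swap) (simp add: add.commute)
      have "(\<Sum>s\<in>S. \<Sum>s'\<in>S. measure M (B s \<inter> B s')) = (\<Sum>t\<in>F. \<Sum>i\<in>J t. \<Sum>u\<in>F. \<Sum>l\<in>J u. measure M (b t i \<inter> b u l))"
        unfolding B_def sumS[of "\<lambda>t i. \<Sum>s'\<in>S. measure M (b t i \<inter> b (fst s') (snd s'))"]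
        by (intro sum.cong refl sumS)
      also have "\<dots> = (\<Sum>t\<in>F. \<Sum>u\<in>F. G t u)"
        unfolding G_def by (intro sum.cong refl sum.swap)
      also have "\<dots> \<le> (\<Sum>t\<in>F. \<Sum>u\<in>F. K * (w t * w u + (1/2) ^ ((u - t) + (t - u)) * (w t + w u)))"
        by (intro sum_mono G)
      also have "\<dots> = K * ((\<Sum>t\<in>F. \<Sum>u\<in>F. w t * w u)
          + ((\<Sum>t\<in>F. \<Sum>u\<in>F. (1/2) ^ ((u - t) + (t - u)) * w t) + (\<Sum>t\<in>F. \<Sum>u\<in>F. (1/2) ^ ((u - t) + (t - u)) * w u)))"
        by (simp only: sum_distrib_left[symmetric] sum.distrib distrib_left)
      also have "\<dots> \<le> K * (W * W + (4 * W + 4 * W))"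
        using half half' K by (intro mult_left_mono add_mono) (auto simp: W_def sum_product)
      also have "\<dots> \<le> K * (9 * W\<^sup>2)"
        using W K by (intro mult_left_mono) (auto simp: power2_eq_square)
      finally show ?thesis by (simp add: ac_simps)
    qed
    have "2 * (a * W) * (c * W * \<gamma>) \<le> 9 * K * W\<^sup>2 + (a * W)\<^sup>2 * (measure M (V n) - \<gamma>)"
      if "a \<ge> 0"
    proof -
      have "2 * (a * W) * (c * W * \<gamma>) \<le> 2 * (a * W) * (\<Sum>s\<in>S. measure M (B s \<inter> (V n - C)))"
        using lo that W by (intro mult_left_mono) auto
      also have "\<dots> \<le> (\<Sum>s\<in>S. \<Sum>s'\<in>S. measure M (B s \<inter> B s')) + (a * W)\<^sup>2 * measure M (V n - C)"
        using finS B_fm V_fm C_fm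
        by (intro sum_measure_Int_le fmeasurable_Diff) (auto dest: fmeasurableD)
      finally show ?thesis using up unfolding V_C by linarith
    qed
    then have "W\<^sup>2 * (2 * a * c * \<gamma>) \<le> W\<^sup>2 * (9 * K + a\<^sup>2 * (measure M (V n) - \<gamma>))"
      using a by (simp add: power2_eq_square algebra_simps)
    then show ?thesis using W by (simp add: mult_le_cancel_left)
  qed
  have "\<gamma> = 0"
  proof (rule ccontr)
    assume "\<gamma> \<noteq> 0"
    then have \<gamma>: "\<gamma> > 0" by (simp add: \<gamma>_def zero_less_measure_iff)
    \<comment> \<open>Chosen so that the left side of \<open>key\<close> becomes
      \<open>18 * K + 2 * c * \<gamma>\<close>, which exceeds the limit \<open>9 * K\<close> of the
      right side.\<close>
    define a where "a = 9 * K / (c * \<gamma>) + 1"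
    have a: "a \<ge> 0" using K c \<gamma> by (simp add: a_def)
    have "(\<lambda>n. 9 * K + a\<^sup>2 * (measure M (V n) - \<gamma>)) \<longlonglongrightarrow> 9 * K + a\<^sup>2 * (\<gamma> - \<gamma>)"
      using V_lim unfolding \<gamma>_def by (intro tendsto_intros)
    then have "2 * a * c * \<gamma> \<le> 9 * K + a\<^sup>2 * (\<gamma> - \<gamma>)"
      using key a by (intro LIMSEQ_le_const) auto
    moreover have "2 * a * c * \<gamma> = 18 * K + 2 * c * \<gamma>"
      using c \<gamma> by (simp add: a_def field_simps)
    moreover have "0 < c * \<gamma>" using c \<gamma> by simp
    ultimately show False using K by simp
  qed
  then show ?thesis
    using C_fm unfolding \<gamma>_def C_def[symmetric]
    by (intro null_setsI) (auto simp: fmeasurable_def emeasure_eq_ennreal_measure)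
qed

section \<open>Cubes around separated rational points\<close>

text \<open>
  A scale \<open>t\<close> stands for the denominators up to \<open>2 ^ t\<close>, and \<open>\<delta> t\<close> for the admissible error.
  Dirichlet's theorem with error \<open>\<delta> t\<close> in the fixed coordinate leaves the error \<open>1 / m t\<close> in the
  coordinates indexed by \<open>I\<close>.
\<close>

locale approximation_scales =
  fixes I :: "'a set" and x :: real and \<delta> :: "nat \<Rightarrow> real" and T :: "nat set"
  assumes finite_I: "finite I" and I_nonempty: "I \<noteq> {}"
    and \<delta>_pos: "t \<in> T \<Longrightarrow> 0 < \<delta> t"
    and weight_le_1: "t \<in> T \<Longrightarrow> 2 ^ t * \<delta> t ^ (card I + 1) \<le> 1"
    and growth: "t \<in> T \<Longrightarrow> u \<in> T \<Longrightarrow> t \<le> u \<Longrightarrow> 2 ^ t * \<delta> t \<le> 2 ^ u * \<delta> u"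
    and unbounded: "\<exists>t0. \<forall>t\<in>T. t \<ge> t0 \<longrightarrow> B \<le> 2 ^ t * \<delta> t"
    and ge_2: "t \<in> T \<Longrightarrow> 2 \<le> 2 ^ t * \<delta> t"
    and separated: "t \<in> T \<Longrightarrow> 4 * card I + 7 \<le> t \<and>
       (\<exists>H. separating x H \<and> H \<le> 2 ^ (t - (4 * card I + 7)) \<and> 1 \<le> \<delta> t * H)"
begin

section \<open>Dirichlet's theorem at one scale\<close>

abbreviation k :: nat where "k \<equiv> card I"

text \<open>Denominators up to \<open>2 ^ (t - e)\<close> will be discarded. The choice makes
  \<open>2 ^ e = 128 * 16 ^ k\<close>, which outweighs the factors 10, \<open>2 ^ (k + 1)\<close>
  and \<open>8 ^ k\<close> in the measure estimate for \<open>bad t\<close>.\<close>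

abbreviation e :: nat where "e \<equiv> 4 * card I + 7"

definition w :: "nat \<Rightarrow> real" where
  "w t = 2 ^ t * \<delta> t ^ (k + 1)"

text \<open>The division by 2 pays for rounding \<open>1 / \<delta> t\<close> up to an integer, so
  that Dirichlet's theorem needs no denominators beyond \<open>2 ^ t\<close>.\<close>

definition m :: "nat \<Rightarrow> nat" where
  "m t = nat \<lfloor>root k (2 ^ t * \<delta> t / 2)\<rfloor>"

text \<open>A Dirichlet fraction with denominator about \<open>2 ^ t\<close> is within about
  \<open>1 / M t\<close> of its point in each free coordinate, so this is the natural side of a
  cell.\<close>

abbreviation M :: "nat \<Rightarrow> real" where
  "M t \<equiv> 2 ^ t * real (m t)"

abbreviation r :: "nat \<Rightarrow> real" where
  "r t \<equiv> \<delta> t / 2 ^ t"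

definition near :: "nat \<Rightarrow> nat \<Rightarrow> bool" where
  "near t q \<longleftrightarrow> (\<exists>p::int. \<bar>real q * x - p\<bar> < \<delta> t)"

text \<open>For such a point Dirichlet's theorem may return a small \<open>q\<close>, and then the
  fraction can be many cells away from the point.\<close>

definition bad :: "nat \<Rightarrow> ('a \<Rightarrow> real) set" where
  "bad t = {y. \<exists>q\<in>{1..2 ^ (t - e)}. near t q \<and> (\<forall>i\<in>I. \<exists>p::int. \<bar>real q * y i - p\<bar> < 1 / m t)}"

lemma k_pos: "k \<ge> 1"
  using finite_I I_nonempty by (simp add: Suc_le_eq card_gt_0_iff)

context
  fixes t assumes t: "t \<in> T"
begin

lemma m_pos: "m t \<ge> 1"
proof -
  have "1 \<le> root k (2 ^ t * \<delta> t / 2)" using ge_2[OF t] k_pos by simp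
  then show ?thesis by (simp add: m_def le_nat_iff le_floor_iff)
qed

lemma m_power_le: "real (m t) ^ k \<le> 2 ^ t * \<delta> t / 2"
proof -
  have nn: "0 \<le> 2 ^ t * \<delta> t / 2" using \<delta>_pos[OF t] by simp
  then have "0 \<le> root k (2 ^ t * \<delta> t / 2)" by (rule real_root_ge_zero)
  then have "real (m t) ^ k \<le> root k (2 ^ t * \<delta> t / 2) ^ k"
    by (intro power_mono) (auto simp: m_def)
  then show ?thesis using nn k_pos by simp
qed

text \<open>The root is at most \<open>m t + 1 \<le> 2 * m t\<close>. Rounding thus costs
  \<open>2 ^ k\<close>, and the halving in \<open>m\<close> one more factor 2.\<close>

lemma le_m_power: "2 ^ t * \<delta> t \<le> 2 ^ (k + 1) * real (m t) ^ k"
proof -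
  have nn: "0 \<le> 2 ^ t * \<delta> t / 2" using \<delta>_pos[OF t] by simp
  have "0 \<le> root k (2 ^ t * \<delta> t / 2)" using nn by (rule real_root_ge_zero)
  moreover have "root k (2 ^ t * \<delta> t / 2) \<le> real (m t) + 1"
    using calculation by (simp add: m_def)
  then have "root k (2 ^ t * \<delta> t / 2) \<le> 2 * real (m t)" using m_pos by simp
  ultimately have "root k (2 ^ t * \<delta> t / 2) ^ k \<le> (2 * real (m t)) ^ k"
    by (intro power_mono)
  then show ?thesis using nn k_pos by (simp add: power_mult_distrib)
qed

lemma M_ge: "M t \<ge> 2 ^ t"
  using m_pos by simp

lemma M_pos: "M t > 0"
  using m_pos by simp

lemma r_M_power_le: "(r t * M t) ^ k \<le> w t"
proof -
  have "(r t * M t) ^ k = \<delta> t ^ k * real (m t) ^ k" by (simp add: power_mult_distrib)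
  also have "\<dots> \<le> \<delta> t ^ k * (2 ^ t * \<delta> t / 2)"
    using m_power_le \<delta>_pos[OF t] by (intro mult_left_mono) auto
  also have "\<dots> \<le> w t" using \<delta>_pos[OF t] by (simp add: w_def)
  finally show ?thesis .
qed

lemma r_M_power_ge: "w t \<le> 2 ^ (k + 1) * (r t * M t) ^ k"
proof -
  have "w t = \<delta> t ^ k * (2 ^ t * \<delta> t)" by (simp add: w_def)
  also have "\<dots> \<le> \<delta> t ^ k * (2 ^ (k + 1) * real (m t) ^ k)"
    using le_m_power \<delta>_pos[OF t] by (intro mult_left_mono) auto
  also have "\<dots> = 2 ^ (k + 1) * (r t * M t) ^ k" by (simp add: power_mult_distrib)
  finally show ?thesis .
qed

lemma r_M_le_1: "r t * M t \<le> 1"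
proof (rule ccontr)
  assume "\<not> r t * M t \<le> 1"
  then have "1 < (r t * M t) ^ k" using k_pos by (intro one_less_power) auto
  then show False using r_M_power_le weight_le_1[OF t] by (simp add: w_def)
qed

lemma \<delta>_le_1: "\<delta> t \<le> 1"
proof (rule ccontr)
  assume "\<not> \<delta> t \<le> 1"
  then have "1 < \<delta> t ^ (k + 1)" by (intro one_less_power) auto
  moreover have "\<delta> t ^ (k + 1) \<le> 2 ^ t * \<delta> t ^ (k + 1)"
    using mult_right_mono[of 1 "2 ^ t" "\<delta> t ^ (k + 1)"] \<delta>_pos[OF t] by simp
  ultimately show False using weight_le_1[OF t] by linarith
qed

lemma Dirichlet_at_scale:
  assumes "y \<notin> bad t"
  shows "\<exists>q. 2 ^ (t - e) < q \<and> q \<le> 2 ^ t \<and> near t q \<and> (\<forall>i\<in>I. \<exists>p::int. \<bar>real q * y i - p\<bar> < 1 / m t)"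
proof -
  define D where "D = nat \<lceil>1 / \<delta> t\<rceil>"
  have inv: "1 \<le> 1 / \<delta> t" using \<delta>_pos[OF t] \<delta>_le_1 by simp
  then have D: "1 / \<delta> t \<le> D" "D \<le> 2 / \<delta> t"
    unfolding D_def by linarith+
  have D1: "D \<ge> 1" using D inv by linarith
  \<comment> \<open>The index \<open>None\<close> stands for the fixed coordinate \<open>x\<close>,
    the indices \<open>Some i\<close> for the free ones. From \<open>D \<le> 2 / \<delta> t\<close>
    the number of boxes is at most \<open>2 ^ t\<close>.\<close>
  define n where "n = case_option D (\<lambda>_::'a. m t)"
  define y' where "y' = case_option x y"
  have "(\<Prod>j\<in>insert None (Some ` I). n j) = D * m t ^ k"
    using finite_I by (simp add: prod.reindex n_def)
  moreover have "D * m t ^ k \<le> 2 ^ t"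
  proof -
    have "real D * real (m t) ^ k \<le> (2 / \<delta> t) * (2 ^ t * \<delta> t / 2)"
      using D m_power_le \<delta>_pos[OF t] by (intro mult_mono) auto
    then have "real (D * m t ^ k) \<le> real (2 ^ t)" using \<delta>_pos[OF t] by simp
    then show ?thesis by linarith
  qed
  ultimately obtain q where q: "q \<in> {1..2 ^ t}"
    "\<And>j. j \<in> insert None (Some ` I) \<Longrightarrow> \<exists>p::int. \<bar>real q * y' j - p\<bar> < 1 / n j"
    using simultaneous_Dirichlet[of "insert None (Some ` I)" n "2 ^ t" y'] finite_I D1 m_pos
    by (fastforce simp: n_def split: option.splits)
  have "near t q"
  proof -
    obtain p :: int where "\<bar>real q * x - p\<bar> < 1 / D" using q(2)[of None] by (auto simp: n_def y'_def)
    moreover have "1 / D \<le> \<delta> t" using D(1) \<delta>_pos[OF t] D1 by (simp add: field_simps)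
    ultimately show ?thesis unfolding near_def by (intro exI[of _ p]) linarith
  qed
  moreover have "\<forall>i\<in>I. \<exists>p::int. \<bar>real q * y i - p\<bar> < 1 / m t"
    using q(2)[of "Some i" for i] by (force simp: n_def y'_def)
  ultimately have approx: "near t q \<and> (\<forall>i\<in>I. \<exists>p::int. \<bar>real q * y i - p\<bar> < 1 / m t)" by blast
  then have "q \<notin> {1..2 ^ (t - e)}" using assms unfolding bad_def by blast
  then have "2 ^ (t - e) < q" using q(1) by auto
  then show ?thesis using approx q(1) by auto
qed

end

section \<open>Rational centres attached to the good cells\<close>

definition selected :: "nat \<Rightarrow> nat \<Rightarrow> ('a \<Rightarrow> int) set" where
  "selected R t = cell_index I (M t) ` (big_cube I R - bad t)"

definition is_center :: "nat \<Rightarrow> ('a \<Rightarrow> int) \<Rightarrow> ('a \<Rightarrow> real) \<Rightarrow> bool" where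
  "is_center t j z \<longleftrightarrow> (\<exists>q (p :: 'a \<Rightarrow> int) y. 2 ^ (t - e) < q \<and> q \<le> 2 ^ t \<and> near t q \<and>
     (\<forall>i\<in>I. j i = \<lfloor>M t * y i\<rfloor> \<and> z i = p i / real q \<and> \<bar>real q * y i - p i\<bar> < 1 / m t))"

definition center :: "nat \<Rightarrow> ('a \<Rightarrow> int) \<Rightarrow> 'a \<Rightarrow> real" where
  "center t j = (SOME z. is_center t j z)"

lemma is_center_center:
  assumes t: "t \<in> T" and j: "j \<in> selected R t"
  shows "is_center t j (center t j)"
proof -
  obtain y where y: "y \<notin> bad t" "j = cell_index I (M t) y"
    using j by (auto simp: selected_def)
  obtain q where q: "2 ^ (t - e) < q" "q \<le> 2 ^ t" "near t q" "\<forall>i\<in>I. \<exists>p::int. \<bar>real q * y i - p\<bar> < 1 / m t"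
    using Dirichlet_at_scale[OF t y(1)] by blast
  obtain p :: "'a \<Rightarrow> int" where p: "\<forall>i\<in>I. \<bar>real q * y i - p i\<bar> < 1 / m t"
    using bchoice[OF q(4)] by blast
  have "is_center t j (\<lambda>i. p i / real q)"
    unfolding is_center_def using q p y(2) by (intro exI[of _ q] exI[of _ p] exI[of _ y]) (auto simp: cell_index_def)
  then show ?thesis unfolding center_def by (rule someI[of "is_center t j"])
qed

text \<open>As \<open>q > 2 ^ (t - e)\<close>, the distance bound \<open>1 / (q * m t)\<close> is
  less than \<open>2 ^ e\<close> cell sides. This is the form of separation used: several cells may
  share a centre, but only boundedly many have their centre within a cell side of a given
  point.\<close>

lemma center_near:
  assumes t: "t \<in> T" and j: "j \<in> selected R t" and i: "i \<in> I"
  shows "\<bar>M t * center t j i - j i\<bar> < 2 ^ e + 1"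
proof -
  obtain q and p :: "'a \<Rightarrow> int" and y where q: "2 ^ (t - e) < q" "q \<le> 2 ^ t"
    and y: "j i = \<lfloor>M t * y i\<rfloor>" "center t j i = p i / real q" "\<bar>real q * y i - p i\<bar> < 1 / m t"
    using is_center_center[OF t j] i unfolding is_center_def by blast
  have q0: "real q > 0" using q by simp
  have "(2::real) ^ t = 2 ^ e * 2 ^ (t - e)" using separated[OF t] by (simp flip: power_add)
  moreover have "(2::real) ^ (t - e) < real q" using q(1) by (metis of_nat_less_iff of_nat_numeral of_nat_power)
  ultimately have tq: "(2::real) ^ t \<le> 2 ^ e * real q" by simp
  have "\<bar>M t * y i - M t * center t j i\<bar> = M t * \<bar>real q * y i - p i\<bar> / real q"
  proof -
    have "M t * y i - M t * center t j i = M t * (real q * y i - p i) / real q"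
      using q0 by (simp add: y(2) field_simps)
    then show ?thesis using q0 M_pos[OF t] by (simp add: abs_mult)
  qed
  also have "\<dots> \<le> M t * (1 / m t) / real q"
    using y(3) q0 M_pos[OF t] by (intro divide_right_mono mult_left_mono) auto
  also have "\<dots> = 2 ^ t / real q" using m_pos[OF t] by simp
  also have "\<dots> \<le> 2 ^ e" using tq q0 by (simp add: field_simps)
  finally show ?thesis using y(1) by linarith
qed

lemma approximable_in_cube:
  assumes t: "t \<in> T" and j: "j \<in> selected R t" and y: "y \<in> open_cube I (r t) (center t j)"
  shows "\<exists>q. 2 ^ (t - e) < q \<and> q \<le> 2 ^ t \<and> near t q \<and> (\<forall>i\<in>I. \<exists>p::int. \<bar>real q * y i - p\<bar> < \<delta> t)"
proof -
  obtain q and p :: "'a \<Rightarrow> int" where q: "2 ^ (t - e) < q" "q \<le> 2 ^ t" "near t q"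
    and z: "\<And>i. i \<in> I \<Longrightarrow> center t j i = p i / real q"
    using is_center_center[OF t j] unfolding is_center_def by blast
  have q0: "real q > 0" using q by simp
  have q2: "real q \<le> 2 ^ t" using q(2) by (metis of_nat_le_iff of_nat_numeral of_nat_power)
  have "\<bar>real q * y i - p i\<bar> < \<delta> t" if i: "i \<in> I" for i
  proof -
    have "\<bar>y i - p i / real q\<bar> < r t"
      using y i z[OF i] by (auto simp: open_cube_def PiE_iff abs_less_iff dest!: bspec)
    then have "real q * \<bar>y i - p i / real q\<bar> < real q * r t"
      using q0 by (intro mult_strict_left_mono)
    also have "\<dots> \<le> 2 ^ t * r t" using q2 \<delta>_pos[OF t] by (intro mult_right_mono) auto
    also have "real q * \<bar>y i - p i / real q\<bar> = \<bar>real q * y i - p i\<bar>"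
      using q0 by (simp add: abs_mult_pos' right_diff_distrib flip: abs_mult)
    finally show ?thesis by simp
  qed
  then show ?thesis using q by blast
qed

lemma finite_selected:
  assumes "t \<in> T"
  shows "finite (selected R t)"
  unfolding selected_def using finite_I M_pos[OF assms] by (intro finite_cell_index_big_cube) auto

lemma card_selected:
  assumes "t \<in> T"
  shows "real (card (selected R t)) \<le> (2 * real R * M t) ^ k"
proof -
  have "selected R t \<subseteq> (\<Pi>\<^sub>E i\<in>I. {- \<lceil>R * M t\<rceil>..<\<lceil>R * M t\<rceil>})"
    unfolding selected_def using cell_index_big_cube M_pos[OF assms] by fast
  then have "card (selected R t) \<le> card (\<Pi>\<^sub>E i\<in>I. {- \<lceil>R * M t\<rceil>..<\<lceil>R * M t\<rceil>})"
    using finite_I by (intro card_mono finite_PiE) auto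
  \<comment> \<open>\<open>M t\<close> is a natural number, so the ceiling is exact and the count
    has no boundary term.\<close>
  also have "\<lceil>R * M t\<rceil> = int (R * (2 ^ t * m t))"
  proof -
    have "R * M t = real (R * (2 ^ t * m t))" by simp
    then show ?thesis by (simp only: ceiling_of_nat)
  qed
  also have "card (\<Pi>\<^sub>E i\<in>I. {- int (R * (2 ^ t * m t))..<int (R * (2 ^ t * m t))}) = (2 * (R * (2 ^ t * m t))) ^ k"
  proof -
    have "card {- int n..<int n} = 2 * n" for n by (simp add: nat_mult_distrib)
    then show ?thesis using finite_I by (simp only: card_PiE prod_constant)
  qed
  finally have "real (card (selected R t)) \<le> real ((2 * (R * (2 ^ t * m t))) ^ k)"
    using of_nat_le_iff by blast
  then show ?thesis by (simp add: mult_ac)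
qed

section \<open>Overlaps between the cubes of two scales\<close>

abbreviation cube :: "nat \<Rightarrow> ('a \<Rightarrow> int) \<Rightarrow> ('a \<Rightarrow> real) set" where
  "cube t j \<equiv> open_cube I (r t) (center t j)"

text \<open>If the cubes meet, \<open>l\<close> is within \<open>M u * r t + 2 ^ e + 2\<close> of
  \<open>M u\<close> times the first centre: \<open>M u * r t\<close> for the first radius, 1 for
  the second, \<open>2 ^ e + 1\<close> from \<open>center_near\<close>.\<close>

lemma card_meeting_cubes:
  assumes t: "t \<in> T" and u: "u \<in> T"
  shows "real (card {l \<in> selected R u. cube t j \<inter> cube u l \<noteq> {}}) \<le> (2 * (M u * r t) + 2 ^ (e + 2)) ^ k"
proof -
  define B where "B = 2 ^ e + 2 + M u * r t"
  define c where "c i = M u * center t j i" for i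
  have B0: "B > 0" using M_pos[OF u] \<delta>_pos[OF t] by (simp add: B_def add_pos_nonneg)
  have "{l \<in> selected R u. cube t j \<inter> cube u l \<noteq> {}} \<subseteq> (\<Pi>\<^sub>E i\<in>I. {\<lceil>c i - B\<rceil>..\<lfloor>c i + B\<rfloor>})"
  proof
    fix l assume l: "l \<in> {l \<in> selected R u. cube t j \<inter> cube u l \<noteq> {}}"
    then obtain y where y: "y \<in> cube t j" "y \<in> cube u l" by blast
    have "\<bar>c i - l i\<bar> < B" if i: "i \<in> I" for i
    proof -
      have "\<bar>y i - center t j i\<bar> < r t" "\<bar>y i - center u l i\<bar> < r u"
        using y i by (auto simp: open_cube_def PiE_iff abs_less_iff dest!: bspec)
      then have "\<bar>center t j i - center u l i\<bar> < r t + r u" by linarith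
      then have "M u * \<bar>center t j i - center u l i\<bar> < M u * (r t + r u)"
        using M_pos[OF u] by (intro mult_strict_left_mono)
      moreover have "M u * \<bar>center t j i - center u l i\<bar> = \<bar>c i - M u * center u l i\<bar>"
        using M_pos[OF u] unfolding c_def by (simp add: abs_mult flip: right_diff_distrib)
      moreover have "M u * (r t + r u) = M u * r t + r u * M u" by (simp only: distrib_left mult.commute)
      moreover have "\<bar>M u * center u l i - l i\<bar> < 2 ^ e + 1"
        using l i u by (intro center_near) auto
      ultimately show ?thesis using r_M_le_1[OF u] unfolding B_def by linarith
    qed
    moreover have "l \<in> extensional I" using l by (auto simp: selected_def cell_index_def)
    ultimately show "l \<in> (\<Pi>\<^sub>E i\<in>I. {\<lceil>c i - B\<rceil>..\<lfloor>c i + B\<rfloor>})"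
      by (force simp: PiE_iff ceiling_le_iff le_floor_iff abs_less_iff)
  qed
  then have "card {l \<in> selected R u. cube t j \<inter> cube u l \<noteq> {}} \<le> card (\<Pi>\<^sub>E i\<in>I. {\<lceil>c i - B\<rceil>..\<lfloor>c i + B\<rfloor>})"
    using finite_I by (intro card_mono finite_PiE) auto
  then have "real (card {l \<in> selected R u. cube t j \<inter> cube u l \<noteq> {}}) \<le> (\<Prod>i\<in>I. real (card {\<lceil>c i - B\<rceil>..\<lfloor>c i + B\<rfloor>}))"
    using finite_I by (simp add: card_PiE flip: of_nat_prod)
  also have "\<dots> \<le> (\<Prod>i\<in>I. 2 * B + 1)"
  proof (intro prod_mono conjI)
    fix i
    have "real_of_int (\<lfloor>c i + B\<rfloor> + 1 - \<lceil>c i - B\<rceil>) \<le> 2 * B + 1" by linarith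
    then show "real (card {\<lceil>c i - B\<rceil>..\<lfloor>c i + B\<rfloor>}) \<le> 2 * B + 1"
      using B0 by (cases "\<lceil>c i - B\<rceil> \<le> \<lfloor>c i + B\<rfloor> + 1") (auto simp: of_nat_nat)
  qed simp
  also have "\<dots> = (2 * B + 1) ^ k" by simp
  also have "\<dots> \<le> (2 * (M u * r t) + 2 ^ (e + 2)) ^ k"
  proof (intro power_mono)
    have "(2::real) ^ 7 \<le> 2 ^ e" by (intro power_increasing) auto
    moreover have "(2::real) ^ (e + 2) = 4 * 2 ^ e" by (simp add: power_add)
    moreover have "2 * (a + 2 + b) + 1 \<le> 2 * b + 4 * a" if "2 ^ 7 \<le> a" for a b :: real
      using that by simp
    ultimately show "2 * B + 1 \<le> 2 * (M u * r t) + 2 ^ (e + 2)" unfolding B_def by metis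
  qed (use B0 in simp)
  finally show ?thesis .
qed

text \<open>By \<open>growth\<close> the ratio \<open>m t / m u\<close> has bounded
  \<open>k\<close>-th power, so the decay comes from \<open>2 ^ t / 2 ^ u\<close>; a single power of
  it is kept.\<close>

lemma M_ratio_power_le:
  assumes t: "t \<in> T" and u: "u \<in> T" and tu: "t \<le> u"
  shows "(M t / M u) ^ k \<le> 2 ^ k * (1/2) ^ (u - t)"
proof -
  have "real (m t) ^ k \<le> 2 ^ u * \<delta> u / 2"
    using m_power_le[OF t] growth[OF t u tu] by simp
  also have "\<dots> \<le> 2 ^ k * real (m u) ^ k"
    using le_m_power[OF u] by simp
  finally have m: "(real (m t) / real (m u)) ^ k \<le> 2 ^ k"
    using m_pos[OF u] by (simp add: power_divide field_simps)
  have "(2::real) ^ u = 2 ^ t * 2 ^ (u - t)" using tu by (simp flip: power_add)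
  then have "M t / M u = (1/2) ^ (u - t) * (real (m t) / real (m u))"
    using m_pos[OF u] by (simp add: power_one_over field_simps)
  then have "(M t / M u) ^ k = ((1/2) ^ (u - t)) ^ k * (real (m t) / real (m u)) ^ k"
    by (simp only: power_mult_distrib)
  also have "\<dots> \<le> (1/2) ^ (u - t) * 2 ^ k"
  proof (intro mult_mono m)
    show "((1/2::real) ^ (u - t)) ^ k \<le> (1/2) ^ (u - t)"
      using power_decreasing[of 1 k "(1/2::real) ^ (u - t)"] k_pos by (simp add: power_le_one)
  qed auto
  finally show ?thesis by (simp only: mult.commute)
qed

text \<open>Count the cubes at scale \<open>t\<close>, count those at scale \<open>u\<close> meeting
  one of them, and multiply by the volume of the latter. The part of the second count proportional
  to \<open>M u * r t\<close> yields the independent term \<open>w t * w u\<close>. Its constant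
  part, which dominates when a cube at scale \<open>t\<close> is small compared with a cell at scale
  \<open>u\<close>, yields the decaying term.\<close>

lemma sum_measure_Int_cubes_le:
  fixes R :: nat
  assumes t: "t \<in> T" and u: "u \<in> T" and tu: "t \<le> u"
  defines "K \<equiv> (8 * real R) ^ k * (2 ^ k + 2 ^ ((e + 2) * k) * 2 ^ k)"
  shows "(\<Sum>j\<in>selected R t. \<Sum>l\<in>selected R u. measure (lborel_PiM I) (cube t j \<inter> cube u l))
      \<le> K * (w t * w u + (1/2) ^ (u - t) * w u)"
proof -
  define A where "A = (2 * (M u * r t)) ^ k + (2 ^ (e + 2)) ^ k"
  have r0: "0 \<le> r u" "0 \<le> r t" using \<delta>_pos t u by (simp_all add: less_imp_le)
  have M0: "0 \<le> M t" "0 \<le> M u" by simp_all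
  have w0: "0 \<le> w t" "0 \<le> w u" using \<delta>_pos[OF t] \<delta>_pos[OF u] by (simp_all add: w_def)
  have inner: "(\<Sum>l\<in>selected R u. measure (lborel_PiM I) (cube t j \<inter> cube u l)) \<le> 2 ^ k * A * (2 * r u) ^ k" for j
  proof -
    have "(\<Sum>l\<in>selected R u. measure (lborel_PiM I) (cube t j \<inter> cube u l))
        = (\<Sum>l\<in>{l \<in> selected R u. cube t j \<inter> cube u l \<noteq> {}}. measure (lborel_PiM I) (cube t j \<inter> cube u l))"
      using finite_selected[OF u] by (intro sum.mono_neutral_right) auto
    also have "\<dots> \<le> (\<Sum>l\<in>{l \<in> selected R u. cube t j \<inter> cube u l \<noteq> {}}. (2 * r u) ^ k)"
    proof (intro sum_mono)
      fix l
      have "measure (lborel_PiM I) (cube t j \<inter> cube u l) \<le> measure (lborel_PiM I) (cube u l)"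
        using fmeasurable_open_cube[OF finite_I] r0
        by (intro measure_mono_fmeasurable) (auto dest: fmeasurableD)
      then show "measure (lborel_PiM I) (cube t j \<inter> cube u l) \<le> (2 * r u) ^ k"
        using measure_open_cube[OF finite_I r0(1)] by simp
    qed
    also have "\<dots> = real (card {l \<in> selected R u. cube t j \<inter> cube u l \<noteq> {}}) * (2 * r u) ^ k" by simp
    also have "\<dots> \<le> (2 * (M u * r t) + 2 ^ (e + 2)) ^ k * (2 * r u) ^ k"
      using card_meeting_cubes[OF t u] r0 by (intro mult_right_mono) auto
    also have "\<dots> \<le> 2 ^ k * A * (2 * r u) ^ k"
    proof (intro mult_right_mono)
      have add_power_le: "(a + b) ^ k \<le> 2 ^ k * (a ^ k + b ^ k)" if "0 \<le> a" "0 \<le> b" for a b :: real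
      proof -
        have "(a + b) ^ k \<le> (2 * max a b) ^ k" using that by (intro power_mono) auto
        also have "\<dots> = 2 ^ k * max a b ^ k" by (rule power_mult_distrib)
        also have "\<dots> \<le> 2 ^ k * (a ^ k + b ^ k)"
          using that by (intro mult_left_mono) (auto simp: max_def)
        finally show ?thesis .
      qed
      show "(2 * (M u * r t) + 2 ^ (e + 2)) ^ k \<le> 2 ^ k * A"
        unfolding A_def using mult_nonneg_nonneg[OF M0(2) r0(2)] by (intro add_power_le) (linarith, simp)
    qed (use r0 in auto)
    finally show ?thesis .
  qed
  have first: "(M t * (M u * r t) * r u) ^ k \<le> w t * w u"
  proof -
    have "(M t * (M u * r t) * r u) ^ k = (r t * M t) ^ k * (r u * M u) ^ k"
      by (subst power_mult_distrib[symmetric]) (simp add: mult_ac)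
    also have "\<dots> \<le> w t * w u"
      by (intro mult_mono r_M_power_le t u w0 zero_le_power mult_nonneg_nonneg r0 M0)
    finally show ?thesis .
  qed
  have second: "(M t * r u) ^ k \<le> 2 ^ k * ((1/2) ^ (u - t) * w u)"
  proof -
    have "M t * r u = (M t / M u) * (r u * M u)" using m_pos[OF u] by simp
    then have "(M t * r u) ^ k = (M t / M u) ^ k * (r u * M u) ^ k"
      by (simp only: power_mult_distrib)
    also have "\<dots> \<le> (2 ^ k * (1/2) ^ (u - t)) * w u"
      by (intro mult_mono M_ratio_power_le r_M_power_le t u tu zero_le_power mult_nonneg_nonneg r0 M0) simp_all
    finally show ?thesis by (simp add: mult_ac)
  qed
  have "(\<Sum>j\<in>selected R t. \<Sum>l\<in>selected R u. measure (lborel_PiM I) (cube t j \<inter> cube u l))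
      \<le> real (card (selected R t)) * (2 ^ k * A * (2 * r u) ^ k)"
    using sum_mono[of "selected R t", OF inner] by simp
  also have "\<dots> \<le> (2 * real R * M t) ^ k * (2 ^ k * A * (2 * r u) ^ k)"
  proof (intro mult_right_mono card_selected t)
    show "0 \<le> 2 ^ k * A * (2 * r u) ^ k"
      unfolding A_def by (intro mult_nonneg_nonneg add_nonneg_nonneg zero_le_power r0 M0) simp_all
  qed
  also have "\<dots> = (8 * real R) ^ k * (2 ^ k * (M t * (M u * r t) * r u) ^ k + (2 ^ (e + 2)) ^ k * (M t * r u) ^ k)"
  proof -
    have 8: "(8::real) ^ k = 2 ^ k * (2 ^ k * 2 ^ k)" by (simp flip: power_mult_distrib)
    show ?thesis
      unfolding A_def by (simp only: power_mult_distrib 8 distrib_left distrib_right) (simp only: mult_ac)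
  qed
  also have "\<dots> \<le> (8 * real R) ^ k * (2 ^ k * (w t * w u) + (2 ^ (e + 2)) ^ k * (2 ^ k * ((1/2) ^ (u - t) * w u)))"
    using first second by (intro mult_left_mono add_mono) auto
  also have "\<dots> \<le> K * (w t * w u + (1/2) ^ (u - t) * w u)"
  proof -
    have "2 ^ k * (w t * w u) + (2 ^ (e + 2)) ^ k * (2 ^ k * ((1/2) ^ (u - t) * w u))
        \<le> (2 ^ k + 2 ^ ((e + 2) * k) * 2 ^ k) * (w t * w u + (1/2) ^ (u - t) * w u)"
    proof -
      define X Y a b where "X = w t * w u" and "Y = (1/2) ^ (u - t) * w u"
        and "a = (2::real) ^ k" and "b = (2::real) ^ ((e + 2) * k)"
      have "0 \<le> X" "0 \<le> Y" "0 \<le> a" "0 \<le> b" using w0 by (simp_all add: X_def Y_def a_def b_def)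
      then have "a * X + b * (a * Y) \<le> (a + b * a) * (X + Y)"
        by (simp add: algebra_simps)
      then show ?thesis by (simp only: X_def Y_def a_def b_def power_mult)
    qed
    then have "(8 * real R) ^ k * (2 ^ k * (w t * w u) + (2 ^ (e + 2)) ^ k * (2 ^ k * ((1/2) ^ (u - t) * w u)))
        \<le> (8 * real R) ^ k * ((2 ^ k + 2 ^ ((e + 2) * k) * 2 ^ k) * (w t * w u + (1/2) ^ (u - t) * w u))"
      by (intro mult_left_mono) auto
    then show ?thesis by (simp only: K_def mult.assoc)
  qed
  finally show ?thesis .
qed

text \<open>Union bound over denominators, a quarter of the cell for each of two kinds. Those below
  \<open>2 ^ n\<close> have fractions too sparse for the cell, but they are few and the hypothesis
  on \<open>m t\<close> makes them harmless. Each other denominator takes at most a proportion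
  \<open>(8 / m t) ^ k\<close> of the cell, and \<open>card_near_integer\<close> bounds their
  number.\<close>

lemma bad_Int_cell:
  fixes n :: nat and j :: "'a \<Rightarrow> int"
  assumes t: "t \<in> T" and m: "4 * 2 ^ n * 8 ^ k * (2 ^ n) ^ k \<le> real (m t) ^ k"
  shows "bad t \<inter> cell I (2 ^ n) j \<in> fmeasurable (lborel_PiM I)"
    and "measure (lborel_PiM I) (bad t \<inter> cell I (2 ^ n) j) \<le> (1/2) * (1 / 2 ^ n) ^ k"
proof -
  define s :: real where "s = 2 ^ n"
  have s: "s \<ge> 1" by (simp add: s_def)
  define Q where "Q = {q \<in> {1..2 ^ (t - e)}. near t q}"
  define S where "S q i = {y \<in> {j i / s..<j i / s + 1 / s}. \<exists>p::int. \<bar>real q * y - p\<bar> < 1 / m t}" for q i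
  define E where "E q = (\<Pi>\<^sub>E i\<in>I. S q i)" for q
  have "(j i + 1) / s = j i / s + 1 / s" for i by (simp add: add_divide_distrib)
  then have eq: "bad t \<inter> cell I (2 ^ n) j = (\<Union>q\<in>Q. E q)"
    by (auto simp: bad_def Q_def E_def S_def cell_def s_def PiE_iff)
  have mt: "0 < 1 / real (m t)" "1 / real (m t) \<le> 1" using m_pos[OF t] by auto
  have S: "S q i \<in> fmeasurable lborel" "measure lborel (S q i) \<le> 2 * (1 / m t) * (1 / s + 3 / q)"
    if "q \<in> Q" for q i
    unfolding S_def using that mt s by (intro measure_near_integer; simp add: Q_def)+
  have E_fm: "E q \<in> fmeasurable (lborel_PiM I)" if "q \<in> Q" for q
    unfolding E_def using S[OF that] finite_I by (intro fmeasurable_PiE_lborel)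
  have E_le: "measure (lborel_PiM I) (E q) \<le> (2 * (1 / m t) * (1 / s + 3 / q)) ^ k" if "q \<in> Q" for q
  proof -
    have "measure (lborel_PiM I) (E q) = (\<Prod>i\<in>I. measure lborel (S q i))"
      unfolding E_def using S[OF that] finite_I by (intro measure_PiE_lborel)
    also have "\<dots> \<le> (\<Prod>i\<in>I. 2 * (1 / m t) * (1 / s + 3 / q))"
      using S[OF that] by (intro prod_mono) auto
    finally show ?thesis by simp
  qed
  have finQ: "finite Q" by (simp add: Q_def)
  show "bad t \<inter> cell I (2 ^ n) j \<in> fmeasurable (lborel_PiM I)"
    unfolding eq using finQ E_fm by (intro fmeasurable.finite_UN) auto
  have small: "(8 / m t) ^ k * 2 ^ n \<le> (1/4) * (1 / s) ^ k"
    using m m_pos[OF t] by (simp add: s_def power_divide field_simps)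
  have cardQ: "real (card Q) * (8 / (m t * s)) ^ k \<le> (1/4) * (1 / s) ^ k"
  proof -
    obtain H where H: "separating x H" "H \<le> 2 ^ (t - e)" "1 \<le> \<delta> t * H" "e \<le> t"
      using separated[OF t] by blast
    have te: "(2::real) ^ t = 2 ^ e * 2 ^ (t - e)" using H(4) by (simp flip: power_add)
    have e16: "(2::real) ^ e = 128 * 16 ^ k" by (simp add: power_add power_mult)
    have "real (card Q) \<le> 10 * 2 ^ (t - e) * \<delta> t"
      using card_near_integer[OF H(1-3)] by (simp add: Q_def near_def)
    also have "\<dots> = 10 * (2 ^ t * \<delta> t) / 2 ^ e" by (simp add: te)
    also have "\<dots> \<le> 10 * (2 ^ (k + 1) * real (m t) ^ k) / 2 ^ e"
      using le_m_power[OF t] by (intro divide_right_mono mult_left_mono) auto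
    finally have "real (card Q) * (8 / (m t * s)) ^ k \<le> 10 * (2 ^ (k + 1) * real (m t) ^ k) / 2 ^ e * (8 / (m t * s)) ^ k"
      using s by (intro mult_right_mono) auto
    also have "\<dots> = (20/128) * (1 / s) ^ k"
    proof -
      have "(2::real) ^ k * 8 ^ k = 16 ^ k" by (simp flip: power_mult_distrib)
      then show ?thesis using m_pos[OF t] s
        unfolding e16 by (simp add: power_divide power_mult_distrib field_simps)
    qed
    also have "\<dots> \<le> (1/4) * (1 / s) ^ k" using s by (intro mult_right_mono) auto
    finally show ?thesis .
  qed
  have term_le: "measure (lborel_PiM I) (E q) \<le> (if q < 2 ^ n then (8 / m t) ^ k else (8 / (m t * s)) ^ k)"
    if q: "q \<in> Q" for q
  proof -
    have q1: "real q \<ge> 1" using q by (simp add: Q_def)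
    have "2 * (1 / m t) * (1 / s + 3 / q) \<le> (if q < 2 ^ n then 8 / m t else 8 / (m t * s))"
    proof (cases "q < 2 ^ n")
      case True
      have "1 / s \<le> 1" "3 / real q \<le> 3" using s q1 by (simp_all add: divide_le_eq)
      then have "1 / s + 3 / q \<le> 4" by linarith
      then have "2 * (1 / m t) * (1 / s + 3 / q) \<le> 2 * (1 / m t) * 4"
        by (intro mult_left_mono) auto
      then show ?thesis using True by simp
    next
      case False
      then have "s \<le> q" unfolding s_def by (metis not_less of_nat_le_iff of_nat_numeral of_nat_power)
      then have "3 / q \<le> 3 / s" using s by (intro divide_left_mono) auto
      then have "2 * (1 / m t) * (1 / s + 3 / q) \<le> 2 * (1 / m t) * (4 / s)"
        by (intro mult_left_mono) auto
      then show ?thesis using False by simp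
    qed
    then have "(2 * (1 / m t) * (1 / s + 3 / q)) ^ k \<le> (if q < 2 ^ n then 8 / m t else 8 / (m t * s)) ^ k"
      using s q1 by (intro power_mono) auto
    with E_le[OF q] show ?thesis by (auto split: if_splits)
  qed
  have "measure (lborel_PiM I) (bad t \<inter> cell I (2 ^ n) j) \<le> (\<Sum>q\<in>Q. measure (lborel_PiM I) (E q))"
    unfolding eq using finQ E_fm by (intro measure_UNION_le) (auto dest: fmeasurableD)
  also have "\<dots> \<le> (\<Sum>q\<in>Q. (if q < 2 ^ n then (8 / m t) ^ k else 0) + (8 / (m t * s)) ^ k)"
    using term_le s by (intro sum_mono) (fastforce split: if_splits intro: order_trans)
  also have "\<dots> = (\<Sum>q\<in>Q. (if q < 2 ^ n then (8 / m t) ^ k else 0)) + real (card Q) * (8 / (m t * s)) ^ k"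
    by (simp add: sum.distrib)
  also have "(\<Sum>q\<in>Q. (if q < 2 ^ n then (8 / m t) ^ k else 0)) = (8 / m t) ^ k * real (card {q \<in> Q. q < 2 ^ n})"
    using finQ by (simp add: sum.If_cases Int_def)
  also have "\<dots> \<le> (8 / m t) ^ k * 2 ^ n"
  proof -
    have "card {q \<in> Q. q < 2 ^ n} \<le> card {..<2 ^ n :: nat}" by (intro card_mono) auto
    then have "real (card {q \<in> Q. q < 2 ^ n}) \<le> 2 ^ n" by simp
    then show ?thesis by (intro mult_left_mono) auto
  qed
  finally have "measure (lborel_PiM I) (bad t \<inter> cell I (2 ^ n) j) \<le> (8 / m t) ^ k * 2 ^ n + real (card Q) * (8 / (m t * s)) ^ k"
    by simp
  also have "\<dots> \<le> (1/2) * (1 / s) ^ k" using small cardQ by linarith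
  finally show "measure (lborel_PiM I) (bad t \<inter> cell I (2 ^ n) j) \<le> (1/2) * (1 / 2 ^ n) ^ k"
    by (simp add: s_def)
qed

text \<open>Shrinking the cell by a margin \<open>\<eta>\<close> keeps three quarters of it, and
  removing \<open>bad t\<close> still leaves a quarter. At least a quarter of
  \<open>(M t / 2 ^ n) ^ k\<close> small cells are needed to cover that, and the margin keeps their
  cubes inside the large cell.\<close>

lemma sum_measure_cubes_Int_cell_ge:
  fixes n :: nat and j0 :: "'a \<Rightarrow> int"
  assumes t: "t \<in> T" and m: "4 * 2 ^ n * 8 ^ k * (2 ^ n) ^ k \<le> real (m t) ^ k"
    and M: "8 * (2 ^ e + 3) * 2 ^ n * k \<le> M t"
    and j0: "j0 \<in> cell_index I (2 ^ n) ` big_cube I R"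
  shows "(1/8) * w t * measure (lborel_PiM I) (cell I (2 ^ n) j0)
     \<le> (\<Sum>j\<in>selected R t. measure (lborel_PiM I) (cube t j \<inter> cell I (2 ^ n) j0))"
proof -
  define s :: real where "s = 2 ^ n"
  have s: "s \<ge> 1" by (simp add: s_def)
  \<comment> \<open>In units of the small cell side: \<open>2 ^ e + 1\<close> from the centre to the
    index, 1 from the index to the point, 1 for the radius of the cube.\<close>
  define \<eta> where "\<eta> = (2 ^ e + 3) / M t"
  have \<eta>0: "\<eta> > 0" using M_pos[OF t] by (simp add: \<eta>_def add_pos_pos)
  have \<eta>k: "real k * (2 * \<eta> * s) \<le> 1/4"
    using M M_pos[OF t] by (simp add: \<eta>_def s_def field_simps)
  have \<eta>s: "2 * \<eta> * s \<le> 1/4"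
  proof -
    have "1 * (2 * \<eta> * s) \<le> real k * (2 * \<eta> * s)" using k_pos \<eta>0 s by (intro mult_right_mono) auto
    then show ?thesis using \<eta>k by simp
  qed
  let ?U = "cell I (2 ^ n) j0"
  define U where "U = (\<Pi>\<^sub>E i\<in>I. {j0 i / s + \<eta>..<(j0 i + 1) / s - \<eta>})"
  define G where "G = U - bad t"
  have len: "(j0 i + 1) / s - \<eta> - (j0 i / s + \<eta>) = (1 / s) * (1 - 2 * \<eta> * s)" for i
    using s by (simp add: field_simps)
  have len0: "0 \<le> (1 / s) * (1 - 2 * \<eta> * s)" using \<eta>s s by simp
  have le: "j0 i / s + \<eta> \<le> (j0 i + 1) / s - \<eta>" for i using len[of i] len0 by linarith
  have fm: "{j0 i / s + \<eta>..<(j0 i + 1) / s - \<eta>} \<in> fmeasurable lborel" for i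
    using le[of i] by (simp add: fmeasurable_def)
  have U_fm: "U \<in> fmeasurable (lborel_PiM I)"
    unfolding U_def by (rule fmeasurable_PiE_lborel[OF finite_I fm])
  have "measure (lborel_PiM I) U = (\<Prod>i\<in>I. (1 / s) * (1 - 2 * \<eta> * s))"
    unfolding U_def measure_PiE_lborel[OF finite_I fm] using le len by (intro prod.cong refl) simp
  then have U_m: "measure (lborel_PiM I) U = (1 / s) ^ k * (1 - 2 * \<eta> * s) ^ k"
    by (simp only: prod_constant power_mult_distrib)
  have "(1 - 2 * \<eta> * s) ^ k \<ge> 1 + real k * (- (2 * \<eta> * s))"
    using Bernoulli_inequality[of "- (2 * \<eta> * s)" k] \<eta>s by simp
  then have "(1 - 2 * \<eta> * s) ^ k \<ge> 3/4" using \<eta>k by simp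
  then have U_ge: "measure (lborel_PiM I) U \<ge> (1 / s) ^ k * (3/4)"
    unfolding U_m using s by (intro mult_left_mono) auto
  have U_cell: "U \<subseteq> ?U"
    using \<eta>0 unfolding U_def cell_def s_def by (intro PiE_mono) auto
  have cell_big: "?U \<subseteq> big_cube I R" by (rule cell_subset_big_cube[OF j0])
  note bad = bad_Int_cell[OF t m, of j0]
  have G_eq: "G = U - (bad t \<inter> ?U)" using U_cell by (auto simp: G_def)
  have G_fm: "G \<in> fmeasurable (lborel_PiM I)"
    unfolding G_eq using U_fm bad(1) by (intro fmeasurable_Diff) (auto dest: fmeasurableD)
  have G_ge: "measure (lborel_PiM I) G \<ge> (1/4) * (1 / s) ^ k"
  proof -
    have "measure (lborel_PiM I) U \<le> measure (lborel_PiM I) (G \<union> (bad t \<inter> ?U))"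
      using U_fm G_fm bad(1) U_cell by (intro measure_mono_fmeasurable fmeasurable.Un) (auto simp: G_def dest: fmeasurableD)
    also have "\<dots> \<le> measure (lborel_PiM I) G + measure (lborel_PiM I) (bad t \<inter> ?U)"
      using G_fm bad(1) by (intro measure_Un_le) (auto dest: fmeasurableD)
    finally show ?thesis using U_ge bad(2) by (simp add: s_def)
  qed
  define J where "J = cell_index I (M t) ` G"
  have J_sel: "J \<subseteq> selected R t"
    using U_cell cell_big by (auto simp: J_def selected_def G_def)
  have finJ: "finite J" using J_sel finite_selected[OF t] by (rule finite_subset)
  have G_ext: "y \<in> extensional I" if "y \<in> G" for y using that by (auto simp: G_def U_def PiE_iff)
  have card_J: "(1/4) * (1 / s) ^ k \<le> real (card J) * (1 / M t) ^ k"
  proof -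
    have "G \<subseteq> (\<Union>j\<in>J. cell I (M t) j)"
      using mem_cell_cell_index[OF M_pos[OF t]] G_ext by (auto simp: J_def)
    then have "measure (lborel_PiM I) G \<le> measure (lborel_PiM I) (\<Union>j\<in>J. cell I (M t) j)"
      using G_fm finJ fmeasurable_cell[OF finite_I M_pos[OF t]]
      by (intro measure_mono_fmeasurable fmeasurable.finite_UN) (auto dest: fmeasurableD)
    also have "\<dots> \<le> (\<Sum>j\<in>J. measure (lborel_PiM I) (cell I (M t) j))"
      using finJ fmeasurable_cell[OF finite_I M_pos[OF t]]
      by (intro measure_UNION_le) (auto dest: fmeasurableD)
    also have "\<dots> = real (card J) * (1 / M t) ^ k"
      by (simp only: measure_cell[OF finite_I M_pos[OF t]] sum_constant)
    finally show ?thesis using G_ge by linarith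
  qed
  have cube_sub: "cube t j \<subseteq> ?U" if j: "j \<in> J" for j
  proof
    fix y' assume y': "y' \<in> cube t j"
    obtain y where y: "y \<in> G" "j = cell_index I (M t) y" using j by (auto simp: J_def)
    show "y' \<in> ?U"
      unfolding cell_def PiE_iff
    proof (intro conjI ballI)
      show "y' \<in> extensional I" using y' by (auto simp: open_cube_def PiE_iff)
      have scale: "\<bar>M t * a - M t * b\<bar> = M t * \<bar>a - b\<bar>" for a b
        by (simp add: abs_mult flip: right_diff_distrib)
      fix i assume i: "i \<in> I"
      have "\<bar>M t * center t j i - j i\<bar> < 2 ^ e + 1"
        using center_near[OF t _ i] J_sel j by blast
      moreover have "j i = \<lfloor>M t * y i\<rfloor>" using y(2) i by (simp add: cell_index_def)
      then have "\<bar>M t * y i - j i\<bar> < 1" by linarith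
      ultimately have "\<bar>M t * center t j i - M t * y i\<bar> < 2 ^ e + 2" by linarith
      moreover have "\<bar>M t * y' i - M t * center t j i\<bar> \<le> 1"
      proof -
        have "\<bar>y' i - center t j i\<bar> < r t"
          using y' i by (auto simp: open_cube_def PiE_iff abs_less_iff dest!: bspec)
        then have "M t * \<bar>y' i - center t j i\<bar> \<le> M t * r t"
          using M_pos[OF t] by (intro mult_left_mono) auto
        also have "\<dots> \<le> 1" using r_M_le_1[OF t] by (simp only: mult.commute)
        finally show ?thesis by (simp only: scale)
      qed
      ultimately have "\<bar>M t * y' i - M t * y i\<bar> < 2 ^ e + 3" by linarith
      then have "M t * \<bar>y' i - y i\<bar> < 2 ^ e + 3"
        by (simp only: scale)
      then have "\<bar>y' i - y i\<bar> < \<eta>"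
        unfolding \<eta>_def using M_pos[OF t] by (simp only: pos_less_divide_eq mult.commute)
      moreover have "j0 i / s + \<eta> \<le> y i" "y i < (j0 i + 1) / s - \<eta>"
        using y(1) i by (auto simp: G_def U_def PiE_iff)
      ultimately show "y' i \<in> {real_of_int (j0 i) / 2 ^ n..<(real_of_int (j0 i) + 1) / 2 ^ n}" by (auto simp: s_def)
    qed
  qed
  have r0: "0 \<le> r t" using \<delta>_pos[OF t] by simp
  have "(1/8) * w t * measure (lborel_PiM I) ?U = (1/8) * w t * (1 / s) ^ k"
    using measure_cell[OF finite_I, of "2 ^ n" j0] by (simp add: s_def)
  \<comment> \<open>Of the factor \<open>2 ^ (k + 1)\<close>, one 2 turns 1/8 into the quarter that
    is covered, and \<open>2 ^ k\<close> turns the radii into side lengths.\<close>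
  also have "\<dots> \<le> (1/8) * (2 ^ (k + 1) * (r t * M t) ^ k) * (1 / s) ^ k"
    using r_M_power_ge[OF t] s by (intro mult_right_mono mult_left_mono) auto
  also have "\<dots> = ((1/4) * (1 / s) ^ k) * (2 * r t * M t) ^ k"
    by (simp add: power_mult_distrib)
  also have "\<dots> \<le> (real (card J) * (1 / M t) ^ k) * (2 * r t * M t) ^ k"
    using card_J r0 by (intro mult_right_mono zero_le_power mult_nonneg_nonneg) simp_all
  also have "\<dots> = real (card J) * (2 * r t) ^ k"
    using m_pos[OF t] by (simp add: power_mult_distrib power_divide)
  also have "\<dots> = (\<Sum>j\<in>J. measure (lborel_PiM I) (cube t j \<inter> ?U))"
    using cube_sub measure_open_cube[OF finite_I r0] by (simp add: Int_absorb2)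
  also have "\<dots> \<le> (\<Sum>j\<in>selected R t. measure (lborel_PiM I) (cube t j \<inter> ?U))"
    using J_sel finite_selected[OF t] by (intro sum_mono2) auto
  finally show ?thesis .
qed

lemma sum_measure_cubes_Int_cell_ge_eventually:
  "\<exists>t0. \<forall>t\<in>T. t \<ge> t0 \<longrightarrow> (\<forall>j0\<in>cell_index I (2 ^ n) ` big_cube I R.
     (1/8) * w t * measure (lborel_PiM I) (cell I (2 ^ n) j0)
       \<le> (\<Sum>j\<in>selected R t. measure (lborel_PiM I) (cube t j \<inter> cell I (2 ^ n) j0)))"
proof -
  define B1 :: real where "B1 = 4 * 2 ^ n * 8 ^ k * (2 ^ n) ^ k"
  define B2 :: real where "B2 = 8 * (2 ^ e + 3) * 2 ^ n * k"
  obtain t1 where t1: "\<forall>t\<in>T. t \<ge> t1 \<longrightarrow> 2 ^ (k + 1) * B1 \<le> 2 ^ t * \<delta> t"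
    using unbounded[of "2 ^ (k + 1) * B1"] by (rule exE)
  show ?thesis
  proof (intro exI[of _ "max t1 (nat \<lceil>B2\<rceil>)"] ballI impI)
    fix t j0 assume t: "t \<in> T" "max t1 (nat \<lceil>B2\<rceil>) \<le> t" and j0: "j0 \<in> cell_index I (2 ^ n) ` big_cube I R"
    have tt: "t1 \<le> t" "nat \<lceil>B2\<rceil> \<le> t" using t(2) by simp_all
    have "2 ^ (k + 1) * B1 \<le> 2 ^ (k + 1) * real (m t) ^ k"
      by (rule order_trans[OF t1[rule_format, OF t(1) tt(1)] le_m_power[OF t(1)]])
    then have "B1 \<le> real (m t) ^ k" by (rule mult_left_le_imp_le) simp
    moreover have "B2 \<le> M t"
    proof -
      have "B2 \<le> real t" using tt(2) by linarith
      also have "\<dots> \<le> 2 ^ t" by (metis less_exp of_nat_less_iff of_nat_numeral of_nat_power less_imp_le)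
      also have "\<dots> \<le> M t" by (rule M_ge[OF t(1)])
      finally show ?thesis .
    qed
    ultimately show "(1/8) * w t * measure (lborel_PiM I) (cell I (2 ^ n) j0)
       \<le> (\<Sum>j\<in>selected R t. measure (lborel_PiM I) (cube t j \<inter> cell I (2 ^ n) j0))"
      using j0 t(1) unfolding B1_def B2_def by (intro sum_measure_cubes_Int_cell_ge)
  qed
qed

theorem AE_approximable:
  assumes w_div: "\<And>B t0. \<exists>F. finite F \<and> F \<subseteq> T \<inter> {t0..} \<and> B \<le> sum w F"
  shows "AE y in lborel_PiM I. \<forall>t0. \<exists>t\<ge>t0. t \<in> T \<and>
     (\<exists>q. 2 ^ (t - e) < q \<and> q \<le> 2 ^ t \<and> near t q \<and> (\<forall>i\<in>I. \<exists>p::int. \<bar>real q * y i - p\<bar> < \<delta> t))"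
proof -
  define C where "C R t0 = {y\<in>big_cube I R. \<forall>t\<in>T. t \<ge> t0 \<longrightarrow> (\<forall>j\<in>selected R t. y \<notin> cube t j)}" for R t0
  have null: "C R t0 \<in> null_sets (lborel_PiM I)" for R t0
    unfolding C_def
  proof (rule limsup_open_cubes_null)
    show "finite I" by (rule finite_I)
    show "0 < (1/8 :: real)" by simp
    show "0 \<le> (8 * real R) ^ k * (2 ^ k + 2 ^ ((e + 2) * k) * 2 ^ k)" by simp
    show "finite (selected R t)" if "t \<in> T" for t using that by (rule finite_selected)
    show "0 \<le> r t" if "t \<in> T" for t using \<delta>_pos[OF that] by simp
    show "0 \<le> w t" if "t \<in> T" for t using \<delta>_pos[OF that] by (simp add: w_def)
    show "\<exists>F. finite F \<and> F \<subseteq> T \<inter> {t1..} \<and> B \<le> sum w F" for B t1 by (rule w_div)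
    show "\<exists>t0. \<forall>t\<in>T. t0 \<le> t \<longrightarrow> (\<forall>j\<in>cell_index I (2 ^ n) ` big_cube I R.
        1 / 8 * w t * measure (lborel_PiM I) (cell I (2 ^ n) j)
          \<le> (\<Sum>i\<in>selected R t. measure (lborel_PiM I) (cube t i \<inter> cell I (2 ^ n) j)))" for n
      by (rule sum_measure_cubes_Int_cell_ge_eventually)
    show "(\<Sum>i\<in>selected R t. \<Sum>l\<in>selected R u. measure (lborel_PiM I) (cube t i \<inter> cube u l))
        \<le> (8 * real R) ^ k * (2 ^ k + 2 ^ ((e + 2) * k) * 2 ^ k) * (w t * w u + (1/2) ^ (u - t) * w u)"
      if "t \<in> T" "u \<in> T" "t \<le> u" for t u
      by (rule sum_measure_Int_cubes_le[OF that])
  qed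
  have "AE y in lborel_PiM I. \<forall>R t0. y \<notin> C R t0"
    unfolding AE_all_countable using AE_not_in[OF null] by blast
  then show ?thesis
  proof (rule AE_mp, intro AE_I2 impI allI)
    fix y t0 assume y: "y \<in> space (lborel_PiM I)" "\<forall>R t0. y \<notin> C R t0"
    define R where "R = Max (insert 0 ((\<lambda>i. nat (\<lceil>\<bar>y i\<bar>\<rceil> + 1)) ` I))"
    have "y \<in> big_cube I R"
      unfolding big_cube_def PiE_iff
    proof (intro conjI ballI)
      show "y \<in> extensional I" using y(1) by (simp add: space_PiM PiE_iff)
      fix i assume "i \<in> I"
      then have "nat (\<lceil>\<bar>y i\<bar>\<rceil> + 1) \<le> R" unfolding R_def using finite_I by (intro Max_ge) auto
      then have "\<bar>y i\<bar> < R" by linarith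
      then show "y i \<in> {- real R..<real R}" by auto
    qed
    with y(2) have "\<exists>t\<in>T. t \<ge> t0 \<and> (\<exists>j\<in>selected R t. y \<in> cube t j)" unfolding C_def by blast
    then show "\<exists>t\<ge>t0. t \<in> T \<and>
     (\<exists>q. 2 ^ (t - e) < q \<and> q \<le> 2 ^ t \<and> near t q \<and> (\<forall>i\<in>I. \<exists>p::int. \<bar>real q * y i - p\<bar> < \<delta> t))"
      using approximable_in_cube by meson
  qed
qed

end

section \<open>Iterated logarithms and divergence\<close>

lemma filterlim_ln_funpow: "filterlim (ln ^^ k :: real \<Rightarrow> real) at_top at_top"
proof (induction k)
  case 0
  show ?case by (simp add: id_def filterlim_ident)
next
  case (Suc k)
  have "(ln ^^ Suc k :: real \<Rightarrow> real) = (\<lambda>x. ln ((ln ^^ k) x))" by auto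
  then show ?case using filterlim_compose[OF ln_at_top Suc] by simp
qed

lemma eventually_ln_funpow_ge: "\<forall>\<^sub>F x in at_top. \<forall>k\<le>n. (ln ^^ k) x \<ge> (B :: real)"
proof -
  have "\<forall>\<^sub>F x in at_top. \<forall>k\<in>{..n}. (ln ^^ k) x \<ge> B"
    using filterlim_ln_funpow by (intro eventually_ball_finite) (auto simp: filterlim_at_top)
  then show ?thesis by (rule eventually_mono) auto
qed

text \<open>Products of iterated logarithms are bounded by powers of \<open>ln\<close>, so this
  makes them negligible against powers of the argument.\<close>

lemma eventually_ln_power_le: "\<forall>\<^sub>F x in at_top. (C * ln x) ^ n \<le> (x :: real)"
proof -
  have "((\<lambda>u. C ^ n * (u ^ n / exp u)) \<longlongrightarrow> C ^ n * 0) at_top"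
    by (intro tendsto_mult tendsto_const tendsto_power_div_exp_0)
  then have "\<forall>\<^sub>F u in at_top. C ^ n * (u ^ n / exp u) < 1"
    by (intro order_tendstoD(2)[of _ 0]) auto
  then have "\<forall>\<^sub>F u in at_top. (C * u) ^ n \<le> exp u"
    by eventually_elim (simp add: power_mult_distrib field_simps)
  then have "\<forall>\<^sub>F x in at_top. (C * ln x) ^ n \<le> exp (ln x)"
    using ln_at_top by (auto simp: filterlim_iff)
  moreover have "\<forall>\<^sub>F x in at_top. exp (ln x) = (x :: real)"
    using eventually_gt_at_top[of 0] by eventually_elim simp
  ultimately show ?thesis by eventually_elim simp
qed

lemma ln_diff_le_divide:
  fixes a b :: real
  assumes "0 < a" "0 < b"
  shows "ln b - ln a \<le> (b - a) / a"
proof -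
  have "ln (b / a) \<le> b / a - 1" using assms by (intro ln_le_minus_one) auto
  then show ?thesis using assms by (simp add: ln_div diff_divide_distrib)
qed

lemma ln_funpow_mono:
  fixes a b :: real
  assumes "\<And>j. j < k \<Longrightarrow> (ln ^^ j) a > 0" and "a \<le> b"
  shows "(ln ^^ k) a \<le> (ln ^^ k) b"
  using assms(1)
proof (induction k)
  case (Suc k)
  have "(ln ^^ k) a \<le> (ln ^^ k) b" using Suc by auto
  then show ?case using Suc.prems[of k] by simp
qed (use assms in auto)

lemma ln_funpow_le_ln:
  fixes a :: real
  assumes "\<And>j. 1 \<le> j \<Longrightarrow> j < k \<Longrightarrow> (ln ^^ j) a > 0" and "k \<ge> 1"
  shows "(ln ^^ k) a \<le> ln a"
  using assms(2,1)
proof (induction k rule: dec_induct)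
  case (step k)
  have "(ln ^^ Suc k) a = ln ((ln ^^ k) a)" by simp
  also have "\<dots> \<le> (ln ^^ k) a" using step.prems[of k] step.hyps by (intro order_trans[OF ln_le_minus_one]) auto
  also have "\<dots> \<le> ln a" using step by auto
  finally show ?case .
qed simp

section \<open>Products of iterated logarithms, and their change under doubling\<close>

definition log_prod :: "nat \<Rightarrow> real \<Rightarrow> real" where
  "log_prod s q = (\<Prod>k=1..s. (ln ^^ k) q)"

lemma log_prod_ge_1:
  assumes "\<And>k. k \<le> s \<Longrightarrow> (ln ^^ k) q \<ge> 1"
  shows "log_prod s q \<ge> 1"
  unfolding log_prod_def using assms by (intro prod_ge_1) auto

lemma log_prod_mono:
  assumes "\<And>k. k \<le> s \<Longrightarrow> (ln ^^ k) a \<ge> 1" and "a \<le> b"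
  shows "log_prod s a \<le> log_prod s b"
  unfolding log_prod_def
proof (intro prod_mono conjI)
  fix k assume k: "k \<in> {1..s}"
  show "0 \<le> (ln ^^ k) a" using assms(1)[of k] k by auto
  show "(ln ^^ k) a \<le> (ln ^^ k) b"
  proof (rule ln_funpow_mono)
    show "0 < (ln ^^ j) a" if "j < k" for j using assms(1)[of j] that k by auto
  qed (rule assms)
qed

lemma log_prod_le:
  assumes "\<And>k. k \<le> s \<Longrightarrow> (ln ^^ k) q \<ge> 1"
  shows "log_prod s q \<le> ln q ^ s"
proof -
  have "log_prod s q \<le> (\<Prod>k=1..s. ln q)"
    unfolding log_prod_def
  proof (intro prod_mono conjI)
    fix k assume k: "k \<in> {1..s}"
    show "0 \<le> (ln ^^ k) q" using assms[of k] k by auto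
    show "(ln ^^ k) q \<le> ln q"
    proof (rule ln_funpow_le_ln)
      show "0 < (ln ^^ j) q" if "j < k" for j using assms[of j] that k by auto
    qed (use k in auto)
  qed
  then show ?thesis by simp
qed

lemma psi_power:
  assumes "\<And>k. k \<le> s \<Longrightarrow> (ln ^^ k) (real q) \<ge> 1" and "d \<ge> 1"
  shows "psi s d q > 0" and "psi s d q ^ d = 1 / (real q * log_prod s (real q))"
proof -
  have pos: "(ln ^^ k) (real q) > 0" if "k \<le> s" for k using assms(1)[OF that] by simp
  define y where "y = 1 / (real q * log_prod s (real q))"
  have "log_prod s (real q) \<ge> 1" by (rule log_prod_ge_1) (rule assms(1))
  then have y: "y > 0" using pos[of 0] by (simp add: y_def)
  have psi: "psi s d q = y powr (1 / real d)"
    unfolding y_def psi_def log_prod_def using pos by simp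
  then show "psi s d q > 0" using y by simp
  have "psi s d q ^ d = (y powr (1 / real d)) powr real d"
    unfolding psi using y by (simp add: powr_realpow)
  also have "\<dots> = y" using y assms(2) by (simp add: powr_powr)
  finally show "psi s d q ^ d = 1 / (real q * log_prod s (real q))" by (simp add: y_def)
qed

lemma psi_antimono:
  assumes "\<And>k. k \<le> s \<Longrightarrow> (ln ^^ k) (real q) \<ge> 1" and "d \<ge> 1" and "q \<le> q'"
  shows "psi s d q' \<le> psi s d q"
proof -
  have q': "(ln ^^ k) (real q') \<ge> 1" if "k \<le> s" for k
  proof -
    have "(ln ^^ k) (real q) \<le> (ln ^^ k) (real q')"
    proof (rule ln_funpow_mono)
      show "0 < (ln ^^ j) (real q)" if "j < k" for j using assms(1)[of j] that \<open>k \<le> s\<close> by auto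
    qed (use assms in auto)
    then show ?thesis using assms(1)[OF that] by linarith
  qed
  have q0: "real q \<ge> 1" using assms(1)[of 0] by simp
  have "real q * log_prod s q \<le> real q' * log_prod s q'"
    using assms log_prod_mono[of s q q'] log_prod_ge_1[of s q] by (intro mult_mono) auto
  moreover have "0 < real q * log_prod s q"
    using q0 log_prod_ge_1[of s q] assms(1) by (intro mult_pos_pos) force+
  ultimately have "psi s d q' ^ d \<le> psi s d q ^ d"
    using psi_power(2)[OF assms(1,2)] psi_power(2)[OF q' assms(2)] by (simp add: frac_le)
  moreover have "psi s d q > 0" by (rule psi_power(1)[OF assms(1,2)])
  ultimately show ?thesis
    using assms(2) by (cases d) (auto intro: power_le_imp_le_base simp del: power_Suc)
qed

context
  fixes s t :: nat
  assumes ge: "\<And>k. k \<le> Suc s \<Longrightarrow> (ln ^^ k) (2 ^ t :: real) \<ge> max 1 (real s)"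
begin

text \<open>The derivative of the \<open>Suc k\<close>-fold logarithm at \<open>z\<close> is
  \<open>1 / (z * log_prod k z)\<close>. This is the matching mean value estimate between
  \<open>2 ^ t\<close> and \<open>2 ^ Suc t\<close>, obtained by using the concavity of
  \<open>ln\<close> once per level.\<close>

lemma ln_funpow_double_diff:
  assumes "k \<le> s"
  shows "(ln ^^ Suc k) (2 ^ Suc t :: real) - (ln ^^ Suc k) (2 ^ t) \<le> ln 2 / log_prod k (2 ^ t)"
  using assms
proof (induction k)
  case 0
  have "ln (2 ^ Suc t :: real) = ln 2 + ln (2 ^ t)" by (simp add: ln_mult)
  then show ?case by (simp add: log_prod_def)
next
  case (Suc k)
  let ?a = "(ln ^^ Suc k) (2 ^ t :: real)" and ?b = "(ln ^^ Suc k) (2 ^ Suc t :: real)"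
  have a: "?a \<ge> 1" using ge[of "Suc k"] Suc.prems by simp
  have "?a \<le> ?b"
  proof (rule ln_funpow_mono)
    show "0 < (ln ^^ j) (2 ^ t :: real)" if "j < Suc k" for j using ge[of j] that Suc.prems by simp
  qed simp
  have "(ln ^^ Suc (Suc k)) (2 ^ Suc t :: real) - (ln ^^ Suc (Suc k)) (2 ^ t) = ln ?b - ln ?a" by simp
  also have "\<dots> \<le> (?b - ?a) / ?a" using a \<open>?a \<le> ?b\<close> by (intro ln_diff_le_divide) linarith+
  also have "\<dots> \<le> (ln 2 / log_prod k (2 ^ t)) / ?a"
    using Suc a by (intro divide_right_mono) auto
  also have "\<dots> = ln 2 / log_prod (Suc k) (2 ^ t)"
    by (simp only: log_prod_def prod.nat_ivl_Suc' divide_divide_eq_left) (simp add: mult.commute)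
  finally show ?case .
qed

text \<open>The right side is the weight of scale \<open>t\<close> and the left side telescopes, so
  the weights have unbounded sums because the \<open>Suc s\<close>-fold logarithm is
  unbounded.\<close>

lemma inverse_log_prod_ge_diff:
  "(ln ^^ Suc s) (2 ^ Suc t :: real) - (ln ^^ Suc s) (2 ^ t) \<le> 1 / log_prod s (2 ^ t)"
proof -
  have "log_prod s (2 ^ t :: real) \<ge> 1" using ge by (intro log_prod_ge_1) simp
  then have "ln 2 / log_prod s (2 ^ t :: real) \<le> 1 / log_prod s (2 ^ t)"
    using ln_le_minus_one[of 2] by (intro divide_right_mono) auto
  then show ?thesis using ln_funpow_double_diff[of s] by linarith
qed

text \<open>Doubling raises each factor by at most 1, a proportion of at most \<open>1 / s\<close>
  because \<open>ge\<close> asks for values at least \<open>s\<close>; and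
  \<open>(1 + 1 / s) ^ s \<le> exp 1 \<le> 3\<close>. The later application can afford a constant up
  to 4.\<close>

lemma log_prod_double_le: "log_prod s (2 ^ Suc t :: real) \<le> 3 * log_prod s (2 ^ t)"
proof (cases "s = 0")
  case False
  have "log_prod s (2 ^ Suc t :: real) \<le> (\<Prod>k=1..s. (1 + 1 / real s) * (ln ^^ k) (2 ^ t))"
    unfolding log_prod_def
  proof (intro prod_mono conjI)
    fix k assume k: "k \<in> {1..s}"
    then obtain k' where k': "k = Suc k'" "k' \<le> s" by (cases k) auto
    have mono: "(ln ^^ k) (2 ^ t :: real) \<le> (ln ^^ k) (2 ^ Suc t)"
    proof (rule ln_funpow_mono)
      show "0 < (ln ^^ j) (2 ^ t :: real)" if "j < k" for j using ge[of j] that k by simp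
    qed simp
    have k_ge: "(ln ^^ k) (2 ^ t :: real) \<ge> 1" "(ln ^^ k) (2 ^ t :: real) \<ge> real s" using ge[of k] k by auto
    show "0 \<le> (ln ^^ k) (2 ^ Suc t :: real)" using mono k_ge by linarith
    have "log_prod k' (2 ^ t :: real) \<ge> 1" using ge k' by (intro log_prod_ge_1) simp
    then have "ln 2 / log_prod k' (2 ^ t :: real) \<le> 1"
      using ln_le_minus_one[of 2] by (simp add: divide_le_eq)
    then have "(ln ^^ k) (2 ^ Suc t :: real) \<le> (ln ^^ k) (2 ^ t) + 1"
      using ln_funpow_double_diff[of k'] k' by simp
    also have "1 \<le> (1 / real s) * (ln ^^ k) (2 ^ t)" using k_ge(2) False by (simp add: field_simps)
    then have "(ln ^^ k) (2 ^ t) + 1 \<le> (1 + 1 / real s) * (ln ^^ k) (2 ^ t)" by (simp add: distrib_right)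
    finally show "(ln ^^ k) (2 ^ Suc t) \<le> (1 + 1 / real s) * (ln ^^ k) (2 ^ t)" .
  qed
  also have "\<dots> = (1 + 1 / real s) ^ s * log_prod s (2 ^ t)"
    by (simp add: log_prod_def prod.distrib)
  also have "(1 + 1 / real s) ^ s \<le> 3"
    using exp_ge_one_plus_x_over_n_power_n[of s 1] exp_le False by simp
  then have "(1 + 1 / real s) ^ s * log_prod s (2 ^ t) \<le> 3 * log_prod s (2 ^ t)"
    using log_prod_ge_1[of s "2 ^ t"] ge by (intro mult_right_mono) force+
  finally show ?thesis .
qed (simp add: log_prod_def)

end

text \<open>The full sum over a geometric block is compared with the sum over \<open>T\<close> in
  the preceding block, where \<open>W\<close> is at least as large. There \<open>T\<close> has at
  least \<open>a i / 2\<close> elements, against a block length of at most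
  \<open>L\<^sup>2 * a i\<close>; the loss is the factor \<open>2 * L\<^sup>2\<close>.\<close>

lemma sum_over_dense_unbounded:
  fixes W :: "nat \<Rightarrow> real" and T :: "nat set"
  assumes nonneg: "\<And>t. t \<ge> t0 \<Longrightarrow> 0 \<le> W t"
    and anti: "\<And>t u. t0 \<le> t \<Longrightarrow> t \<le> u \<Longrightarrow> W u \<le> W t"
    and div: "\<And>B a. a \<ge> t0 \<Longrightarrow> \<exists>b. B \<le> (\<Sum>t\<in>{a..<b}. W t)"
    and L: "L \<ge> 2" and dense: "\<And>a. a \<ge> t0 \<Longrightarrow> a \<le> 2 * card (T \<inter> {a..<L * a})"
  shows "\<exists>F. finite F \<and> F \<subseteq> T \<inter> {t1..} \<and> B \<le> sum W F"
proof -
  define a where "a i = L ^ i * (t0 + t1 + 1)" for i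
  have a_Suc: "a (Suc i) = L * a i" for i by (simp only: a_def power_Suc mult.assoc)
  have a_ge: "a i \<ge> t0 + t1 + 1" for i
  proof -
    have "1 \<le> L ^ i" using L by (intro one_le_power) simp
    then have "1 * (t0 + t1 + 1) \<le> L ^ i * (t0 + t1 + 1)" by (rule mult_right_mono) simp
    then show ?thesis by (simp only: a_def mult_1)
  qed
  have a_mono: "a i \<le> a (Suc i)" for i using L by (simp add: a_Suc)
  have a_large: "i \<le> a i" for i
  proof -
    have "i < 2 ^ i" by (rule less_exp)
    also have "2 ^ i \<le> L ^ i" using L by (intro power_mono) auto
    also have "\<dots> \<le> a i" by (simp add: a_def)
    finally show ?thesis by simp
  qed
  have block: "(\<Sum>t\<in>{a (Suc i)..<a (Suc (Suc i))}. W t) \<le> 2 * L\<^sup>2 * (\<Sum>t\<in>T \<inter> {a i..<a (Suc i)}. W t)" for i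
  proof -
    have w0: "0 \<le> W (a (Suc i))" using a_ge[of "Suc i"] by (intro nonneg) simp
    have "(\<Sum>t\<in>{a (Suc i)..<a (Suc (Suc i))}. W t) \<le> (\<Sum>t\<in>{a (Suc i)..<a (Suc (Suc i))}. W (a (Suc i)))"
      using a_ge[of "Suc i"] by (intro sum_mono anti) auto
    also have "\<dots> \<le> real (a (Suc (Suc i))) * W (a (Suc i))"
      using w0 by (simp add: mult_right_mono)
    also have "\<dots> = real (L\<^sup>2) * (real (a i) * W (a (Suc i)))"
      by (simp add: a_Suc power2_eq_square mult_ac)
    also have "\<dots> \<le> real (L\<^sup>2) * (2 * real (card (T \<inter> {a i..<a (Suc i)})) * W (a (Suc i)))"
    proof (intro mult_left_mono mult_right_mono w0)
      have "a i \<le> 2 * card (T \<inter> {a i..<a (Suc i)})"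
        unfolding a_Suc using a_ge[of i] by (intro dense) simp
      then show "real (a i) \<le> 2 * real (card (T \<inter> {a i..<a (Suc i)}))" by linarith
    qed simp
    also have "\<dots> = 2 * L\<^sup>2 * (\<Sum>t\<in>T \<inter> {a i..<a (Suc i)}. W (a (Suc i)))" by simp
    also have "\<dots> \<le> 2 * L\<^sup>2 * (\<Sum>t\<in>T \<inter> {a i..<a (Suc i)}. W t)"
      using a_ge[of i] by (intro mult_left_mono sum_mono anti) auto
    finally show ?thesis .
  qed
  have blocks: "(\<Sum>t\<in>{a 1..<a (Suc n)}. W t) \<le> 2 * L\<^sup>2 * (\<Sum>t\<in>T \<inter> {a 0..<a n}. W t)" for n
  proof (induction n)
    case (Suc n)
    have a1: "a 1 \<le> a (Suc n)" "a 0 \<le> a n"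
      by (rule lift_Suc_mono_le[of a], rule a_mono, simp)+
    have "(\<Sum>t\<in>{a 1..<a (Suc (Suc n))}. W t)
        = (\<Sum>t\<in>{a 1..<a (Suc n)}. W t) + (\<Sum>t\<in>{a (Suc n)..<a (Suc (Suc n))}. W t)"
      using a1 a_mono by (simp add: sum.atLeastLessThan_concat)
    also have "\<dots> \<le> 2 * L\<^sup>2 * ((\<Sum>t\<in>T \<inter> {a 0..<a n}. W t) + (\<Sum>t\<in>T \<inter> {a n..<a (Suc n)}. W t))"
      using Suc block[of n] by (simp add: distrib_left)
    also have "(\<Sum>t\<in>T \<inter> {a 0..<a n}. W t) + (\<Sum>t\<in>T \<inter> {a n..<a (Suc n)}. W t) = (\<Sum>t\<in>T \<inter> {a 0..<a (Suc n)}. W t)"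
    proof -
      have "T \<inter> {a 0..<a (Suc n)} = (T \<inter> {a 0..<a n}) \<union> (T \<inter> {a n..<a (Suc n)})"
        using a1 a_mono[of n] by auto
      then show ?thesis by (subst sum.union_disjoint[symmetric]) auto
    qed
    finally show ?case .
  qed simp
  have "a 1 \<ge> t0" using a_ge[of 1] by simp
  then obtain b where b: "2 * L\<^sup>2 * B \<le> (\<Sum>t\<in>{a 1..<b}. W t)" using div by blast
  have "b \<le> a (Suc b)" using a_large[of "Suc b"] by simp
  have "2 * L\<^sup>2 * B \<le> (\<Sum>t\<in>{a 1..<a (Suc b)}. W t)"
    using b \<open>b \<le> a (Suc b)\<close> a_ge[of 1] by (elim order_trans, intro sum_mono2) (auto intro!: nonneg)
  also have "\<dots> \<le> 2 * L\<^sup>2 * (\<Sum>t\<in>T \<inter> {a 0..<a b}. W t)" by (rule blocks)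
  finally have "B \<le> (\<Sum>t\<in>T \<inter> {a 0..<a b}. W t)" using L by simp
  then show ?thesis using a_ge[of 0] by (intro exI[of _ "T \<inter> {a 0..<a b}"]) auto
qed

text \<open>The lower bound on errors places a separating \<open>H\<close> between
  \<open>2 ^ a\<close> and \<open>2 ^ (D * a)\<close>. If \<open>2 ^ u < H \<le> 2 ^ Suc u\<close>,
  every \<open>t\<close> from \<open>Suc u + e\<close> to \<open>2 * u\<close> qualifies; these are
  \<open>u - e \<ge> a / 2\<close> values below \<open>2 * D * a\<close>.\<close>

lemma dense_separating_scales:
  fixes x :: real and D e h0 :: nat
  assumes D: "D \<ge> 1" and h0: "h0 \<ge> 1"
    and badly: "\<And>h (p::int). h \<ge> h0 \<Longrightarrow> \<bar>real h * x - p\<bar> \<ge> 1 / real h ^ D"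
    and a: "a \<ge> 2 * e" "2 ^ a \<ge> h0 ^ 3"
  shows "a \<le> 2 * card ({t. \<exists>H. separating x H \<and> 2 ^ e * H \<le> 2 ^ t \<and> 2 ^ t \<le> H\<^sup>2} \<inter> {a..<2 * D * a})"
proof -
  define X :: nat where "X = 2 ^ a"
  have lower: "\<bar>real_of_int h * x - p\<bar> \<ge> 1 / real (X ^ D)" if h: "0 < h" "h \<le> int X" for h p :: int
  proof (cases "nat h \<ge> h0")
    case True
    have "1 / real (X ^ D) \<le> 1 / real (nat h) ^ D"
      using h by (intro divide_left_mono) (auto intro!: power_mono simp: X_def)
    then show ?thesis using badly[OF True, of p] h by simp
  next
    case False
    \<comment> \<open>For \<open>h < h0\<close> the bound is applied to the multiple
      \<open>h0 * h\<close>. The loss is absorbed by \<open>2 ^ a \<ge> h0 ^ 3\<close>, since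
      \<open>h0 ^ (1 + 2 * D) \<le> h0 ^ (3 * D)\<close>.\<close>
    have "1 / real (h0 * h0) ^ D \<le> 1 / real (h0 * nat h) ^ D"
      using False h h0 by (intro divide_left_mono power_mono) auto
    also have "\<dots> \<le> \<bar>real (h0 * nat h) * x - real_of_int (int h0 * p)\<bar>"
      using h by (intro badly) auto
    also have "\<dots> = real h0 * \<bar>real_of_int h * x - p\<bar>"
    proof -
      have "real (h0 * nat h) * x - real_of_int (int h0 * p) = real h0 * (real_of_int h * x - p)"
        using h by (simp add: algebra_simps)
      then show ?thesis by (simp add: abs_mult)
    qed
    finally have "1 / real (h0 * h0) ^ D \<le> real h0 * \<bar>real_of_int h * x - p\<bar>" .
    then have "1 / (real h0 * real (h0 * h0) ^ D) \<le> \<bar>real_of_int h * x - p\<bar>"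
      using h0 by (simp add: field_simps)
    moreover have "1 / real (X ^ D) \<le> 1 / (real h0 * real (h0 * h0) ^ D)"
    proof -
      have "h0 * (h0 * h0) ^ D \<le> h0 ^ D * (h0 * h0) ^ D"
        using D h0 by (intro mult_right_mono) (auto simp: self_le_power)
      also have "\<dots> = (h0 ^ 3) ^ D"
        by (simp add: power3_eq_cube mult.assoc flip: power_mult_distrib)
      also have "\<dots> \<le> X ^ D" using a by (intro power_mono) (auto simp: X_def)
      finally have "real h0 * real (h0 * h0) ^ D \<le> real (X ^ D)"
        by (metis of_nat_le_iff of_nat_mult of_nat_power)
      then show ?thesis using h0 by (intro divide_left_mono) (auto simp: X_def)
    qed
    ultimately show ?thesis by linarith
  qed
  obtain H where H: "separating x H" "X < H" "H \<le> X ^ D"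
    using separating_exists[of X "X ^ D" x] lower by (auto simp: X_def)
  define u where "u = (GREATEST u. 2 ^ u < H)"
  have ex: "2 ^ a < H" using H by (simp add: X_def)
  have bound: "v \<le> H" if "2 ^ v < H" for v
    using that less_exp[of v] by linarith
  have u: "2 ^ u < H" unfolding u_def using ex bound by (rule GreatestI_nat)
  have u_max: "v \<le> u" if "2 ^ v < H" for v unfolding u_def using that bound by (rule Greatest_le_nat)
  have au: "a \<le> u" by (rule u_max[OF ex])
  have uH: "H \<le> 2 ^ Suc u" using u_max[of "Suc u"] by (meson not_less not_less_eq_eq order_refl)
  have "H \<le> 2 ^ (D * a)"
    using H(3) by (simp add: X_def mult.commute flip: power_mult)
  with u have "2 ^ u < (2::nat) ^ (D * a)" by (rule less_le_trans)
  then have uD: "u < D * a" by simp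
  have "{Suc u + e..2 * u} \<subseteq> {t. \<exists>H. separating x H \<and> 2 ^ e * H \<le> 2 ^ t \<and> 2 ^ t \<le> H\<^sup>2} \<inter> {a..<2 * D * a}"
  proof
    fix t assume t: "t \<in> {Suc u + e..2 * u}"
    have "2 ^ e * H \<le> 2 ^ e * 2 ^ Suc u" using uH by simp
    also have "\<dots> = 2 ^ (Suc u + e)" by (simp add: power_add)
    also have "\<dots> \<le> 2 ^ t" using t by (intro power_increasing) auto
    finally have 1: "2 ^ e * H \<le> 2 ^ t" .
    have "(2::nat) ^ t \<le> 2 ^ (u * 2)" using t by (intro power_increasing) auto
    also have "\<dots> = (2 ^ u)\<^sup>2" by (rule power_mult)
    also have "\<dots> \<le> H\<^sup>2" using u by (intro power_mono) auto
    finally show "t \<in> {t. \<exists>H. separating x H \<and> 2 ^ e * H \<le> 2 ^ t \<and> 2 ^ t \<le> H\<^sup>2} \<inter> {a..<2 * D * a}"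
      using 1 H(1) t au uD by auto
  qed
  then have "card {Suc u + e..2 * u} \<le> card ({t. \<exists>H. separating x H \<and> 2 ^ e * H \<le> 2 ^ t \<and> 2 ^ t \<le> H\<^sup>2} \<inter> {a..<2 * D * a})"
    by (intro card_mono) auto
  moreover have "a \<le> 2 * card {Suc u + e..2 * u}" using au a(1) by simp
  ultimately show ?thesis by linarith
qed

section \<open>Almost every point of the fibre\<close>

lemma well_approxI:
  assumes d: "d \<ge> 1" and y: "y \<in> {1..d} \<rightarrow>\<^sub>E UNIV"
    and approx: "\<And>n. \<exists>q\<ge>n. q \<ge> 1 \<and> (\<forall>i\<in>{1..d}. \<exists>p::int. \<bar>real q * y i - p\<bar> < \<psi> q)"
  shows "y \<in> well_approx d \<psi>"
proof -
  define A where "A = {(p, q). p \<in> {1..d} \<rightarrow>\<^sub>E (UNIV :: int set) \<and> q \<ge> 1 \<and>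
    sup_norm d (\<lambda>i. real q * y i - real_of_int (p i)) < \<psi> q}"
  have "\<exists>q\<ge>n. q \<in> snd ` A" for n
  proof -
    obtain q where q: "q \<ge> n" "q \<ge> 1" "\<forall>i\<in>{1..d}. \<exists>p::int. \<bar>real q * y i - p\<bar> < \<psi> q"
      using approx by blast
    obtain p :: "nat \<Rightarrow> int" where p: "\<forall>i\<in>{1..d}. \<bar>real q * y i - p i\<bar> < \<psi> q"
      using bchoice[OF q(3)] by blast
    have "sup_norm d (\<lambda>i. real q * y i - real_of_int (restrict p {1..d} i)) < \<psi> q"
      unfolding sup_norm_def using d p by (subst Max_less_iff) auto
    then have "(restrict p {1..d}, q) \<in> A" using q by (simp add: A_def)
    then show ?thesis using q(1) by force
  qed
  then have "infinite (snd ` A)" unfolding infinite_nat_iff_unbounded_le by blast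
  then have "infinite A" by (metis finite_imageI)
  then show ?thesis using y unfolding well_approx_def A_def by blast
qed

text \<open>
  If \<open>x\<close> is approximated too well by the fractions of denominator \<open>h\<close>, Dirichlet's theorem for
  \<open>h y\<close> provides a multiple of \<open>h\<close> which is a good denominator for \<open>x\<close> and \<open>y\<close>, whatever \<open>y\<close> is.
\<close>

lemma well_approx_if_very_well_approximable:
  fixes d s :: nat and x :: real
  assumes d: "d \<ge> 1" and y: "y \<in> {1..d} \<rightarrow>\<^sub>E UNIV" "y 1 = x"
    and very_well: "\<And>n. \<exists>h\<ge>n. \<exists>p::int. \<bar>real h * x - p\<bar> < 1 / real h ^ (2 * d)"
  shows "y \<in> well_approx d (psi s d)"
proof (rule well_approxI[OF d y(1)])
  fix n
  \<comment> \<open>The condition on \<open>(2 * d * ln z) ^ s\<close> will bound the logarithmic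
    product at any \<open>q \<le> h ^ (2 * d)\<close> by \<open>h\<close>.\<close>
  have "\<forall>\<^sub>F z in at_top. (\<forall>k\<le>s. (ln ^^ k) z \<ge> (1::real)) \<and> (2 * d * ln z) ^ s \<le> (z::real) \<and> z \<ge> 1"
    by (intro eventually_conj eventually_ln_funpow_ge eventually_ln_power_le eventually_ge_at_top)
  then obtain Z :: real where Z: "\<And>z. z \<ge> Z \<Longrightarrow> (\<forall>k\<le>s. (ln ^^ k) z \<ge> 1) \<and> (2 * d * ln z) ^ s \<le> z \<and> z \<ge> 1"
    by (auto simp: eventually_at_top_linorder)
  obtain h p0 where h: "h \<ge> max n (nat \<lceil>Z\<rceil>)" and p0: "\<bar>real h * x - of_int p0\<bar> < 1 / real h ^ (2 * d)"
    using very_well by blast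
  have hZ: "real h \<ge> Z" using h by linarith
  have h1: "h \<ge> 1" using Z[OF hZ] by simp
  \<comment> \<open>The target error is \<open>1 / h ^ 2\<close>. With
    \<open>m \<le> h ^ (2 * (d - 1))\<close> the denominator \<open>m * h\<close> is at most
    \<open>h ^ (2 * d - 1)\<close>, and one more factor \<open>h\<close> for the logarithms gives
    \<open>psi s d q \<ge> 1 / h ^ 2\<close>. The same \<open>m\<close> enlarges an error
    \<open>1 / h ^ (2 * d)\<close> in \<open>x\<close> to at most \<open>1 / h ^ 2\<close>, which
    explains the exponent \<open>2 * d\<close>.\<close>
  have "(\<Prod>i\<in>{2..d}. h ^ 2) = h ^ (2 * (d - 1))"
    using d by (simp flip: power_mult)
  then obtain m where m: "m \<in> {1..h ^ (2 * (d - 1))}"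
    "\<And>i. i \<in> {2..d} \<Longrightarrow> \<exists>p::int. \<bar>real m * (real h * y i) - p\<bar> < 1 / real (h ^ 2)"
    using simultaneous_Dirichlet[of "{2..d}" "\<lambda>_. h ^ 2" "h ^ (2 * (d - 1))" "\<lambda>i. real h * y i"] h1
    by auto
  define q where "q = m * h"
  have q_ge: "q \<ge> h" using m by (simp add: q_def)
  have "q \<le> h ^ (2 * (d - 1)) * h" using m by (simp add: q_def)
  also have "\<dots> = h ^ (2 * d - 1)" using d by (cases d) simp_all
  finally have q_le: "q \<le> h ^ (2 * d - 1)" .
  have ln_q: "(ln ^^ k) (real q) \<ge> 1" if "k \<le> s" for k using Z[of "real q"] hZ q_ge that by auto
  have psi_ge: "1 / real (h ^ 2) \<le> psi s d q"
  proof -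
    have "log_prod s (real q) \<le> ln (real q) ^ s" by (rule log_prod_le) (rule ln_q)
    also have "\<dots> \<le> (2 * d * ln (real h)) ^ s"
    proof (rule power_mono)
      have "real q \<le> real (h ^ (2 * d))"
        using q_le power_increasing[of "2 * d - 1" "2 * d" h] h1 by (intro of_nat_mono) linarith
      then have "ln (real q) \<le> ln (real h ^ (2 * d))"
        using q_ge h1 by simp
      then show "ln (real q) \<le> 2 * d * ln (real h)" using h1 by (simp add: ln_realpow)
      show "0 \<le> ln (real q)" using q_ge h1 by simp
    qed
    also have "\<dots> \<le> real h" using Z[OF hZ] by blast
    finally have P: "log_prod s (real q) \<le> real h" .
    have P1: "log_prod s (real q) \<ge> 1" by (rule log_prod_ge_1) (rule ln_q)
    have "real q * log_prod s (real q) \<le> real (h ^ (2 * d - 1)) * real h"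
      using q_le P P1 by (intro mult_mono of_nat_mono) auto
    also have "\<dots> = real h ^ (2 * d)" using d by (simp flip: power_Suc2)
    finally have "1 / real h ^ (2 * d) \<le> 1 / (real q * log_prod s (real q))"
      using P1 q_ge h1 by (intro divide_left_mono mult_pos_pos) auto
    also have "\<dots> = psi s d q ^ d" using psi_power(2)[OF ln_q d] by simp
    finally have "(1 / real (h ^ 2)) ^ d \<le> psi s d q ^ d"
      by (simp add: power_divide flip: power_mult)
    then show ?thesis
      using d psi_power(1)[OF ln_q d] by (cases d) (auto intro: power_le_imp_le_base less_imp_le simp del: power_Suc)
  qed
  have "\<exists>p::int. \<bar>real q * y i - p\<bar> < psi s d q" if i: "i \<in> {1..d}" for i
  proof (cases "i = 1")
    case True
    have "\<bar>real q * y i - of_int (int m * p0)\<bar> = real m * \<bar>real h * x - p0\<bar>"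
    proof -
      have "real q * y i - of_int (int m * p0) = real m * (real h * x - p0)"
        using True y(2) by (simp add: q_def algebra_simps)
      then show ?thesis by (simp add: abs_mult)
    qed
    also have "\<dots> < real m * (1 / real h ^ (2 * d))" using p0 m by (intro mult_strict_left_mono) auto
    also have "\<dots> \<le> real (h ^ (2 * (d - 1))) * (1 / real h ^ (2 * d))"
      using m by (intro mult_right_mono of_nat_mono) auto
    also have "\<dots> = 1 / real (h ^ 2)"
    proof -
      have "real h ^ (2 * d) = real h ^ (2 * (d - 1)) * real h ^ 2"
        using d by (cases d) (simp_all add: power2_eq_square)
      then show ?thesis using h1 by simp
    qed
    also have "\<dots> \<le> psi s d q" by (rule psi_ge)
    finally show ?thesis by blast
  next
    case False
    then have "i \<in> {2..d}" using i by auto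
    then obtain p :: int where "\<bar>real m * (real h * y i) - p\<bar> < 1 / real (h ^ 2)" using m(2) by blast
    then show ?thesis using psi_ge unfolding q_def by (intro exI[of _ p]) (simp add: mult.assoc)
  qed
  then show "\<exists>q\<ge>n. q \<ge> 1 \<and> (\<forall>i\<in>{1..d}. \<exists>p::int. \<bar>real q * y i - p\<bar> < psi s d q)"
    using q_ge h h1 by (intro exI[of _ q]) auto
qed

lemma AE_well_approx_if_not_very_well_approximable:
  fixes d s h0 :: nat and x :: real
  assumes d: "d \<ge> 3" and h0: "h0 \<ge> 1"
    and badly: "\<And>h (p::int). h \<ge> h0 \<Longrightarrow> \<bar>real h * x - p\<bar> \<ge> 1 / real h ^ (2 * d)"
  shows "AE y in lborel_PiM {2..d}. y(1 := x) \<in> well_approx d (psi s d)"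
proof -
  define e where "e = 4 * (d - 1) + 7"
  define \<delta> where "\<delta> t = psi s d (2 ^ t)" for t
  define W where "W t = 1 / log_prod s (2 ^ t)" for t
  have "\<forall>\<^sub>F z in at_top. (\<forall>k\<le>Suc s. (ln ^^ k) z \<ge> max 1 (real s)) \<and> (1 * ln z) ^ (2 * s) \<le> (z::real)"
    by (intro eventually_conj eventually_ln_funpow_ge eventually_ln_power_le)
  then obtain Z :: real where Z: "\<And>z. z \<ge> Z \<Longrightarrow> (\<forall>k\<le>Suc s. (ln ^^ k) z \<ge> max 1 (real s)) \<and> (1 * ln z) ^ (2 * s) \<le> z"
    by (auto simp: eventually_at_top_linorder)
  \<comment> \<open>The summands serve the logarithms, \<open>2 ^ t \<ge> 4\<close>, and the
    conditions \<open>2 * e \<le> a\<close> and \<open>h0 ^ 3 \<le> 2 ^ a\<close> of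
    \<open>dense_separating_scales\<close>.\<close>
  define t0 where "t0 = nat \<lceil>Z\<rceil> + 2 + 2 * e + h0 ^ 3"
  have t_less: "real t < 2 ^ t" for t by (metis less_exp of_nat_less_iff of_nat_numeral of_nat_power)
  have Zt: "(2::real) ^ t \<ge> Z" if "t \<ge> t0" for t
  proof -
    have "Z \<le> real t" using that unfolding t0_def by linarith
    then show ?thesis using t_less[of t] by linarith
  qed
  have ln_ge: "(ln ^^ k) (2 ^ t :: real) \<ge> max 1 (real s)" if "t \<ge> t0" "k \<le> Suc s" for k t
    using Z[OF Zt[OF that(1)]] that(2) by blast
  have ln_ge_1: "(ln ^^ k) (2 ^ t :: real) \<ge> 1" if "t \<ge> t0" "k \<le> s" for k t
    using ln_ge[OF that(1), of k] that(2) by simp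
  have P_ge_1: "log_prod s (2 ^ t) \<ge> 1" if "t \<ge> t0" for t
    using ln_ge_1[OF that] by (intro log_prod_ge_1)
  have W_pos: "W t > 0" if "t \<ge> t0" for t using P_ge_1[OF that] by (simp add: W_def)
  have W_le_1: "W t \<le> 1" if "t \<ge> t0" for t using P_ge_1[OF that] by (simp add: W_def)
  have W_anti: "W u \<le> W t" if "t0 \<le> t" "t \<le> u" for t u
    unfolding W_def using P_ge_1[of t] P_ge_1[of u] log_prod_mono[of s "2 ^ t" "2 ^ u"] ln_ge_1[OF that(1)] that
    by (intro divide_left_mono) (auto intro: power_increasing)
  have W_Suc: "W t \<le> 4 * W (Suc t)" if t: "t \<ge> t0" for t
  proof -
    have "log_prod s (2 ^ Suc t) \<le> 4 * log_prod s (2 ^ t)"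
      using log_prod_double_le[of s t, OF ln_ge[OF t]] P_ge_1[OF t] by linarith
    then show ?thesis using P_ge_1[of t] P_ge_1[of "Suc t"] t by (simp add: W_def field_simps)
  qed
  have W_sq: "1 \<le> (W t)\<^sup>2 * 2 ^ t" if t: "t \<ge> t0" for t
  proof -
    have "log_prod s (2 ^ t) \<le> ln (2 ^ t) ^ s" using ln_ge_1[OF t] by (intro log_prod_le)
    then have "(log_prod s (2 ^ t))\<^sup>2 \<le> (ln (2 ^ t) ^ s)\<^sup>2" using P_ge_1[OF t] by (intro power_mono) auto
    also have "\<dots> = (1 * ln (2 ^ t)) ^ (2 * s)" by (simp add: mult.commute flip: power_mult)
    also have "\<dots> \<le> 2 ^ t" using Z[OF Zt[OF t]] by blast
    finally show ?thesis using P_ge_1[OF t] by (simp add: W_def power_divide)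
  qed
  have psi_facts: "\<delta> t > 0" "2 ^ t * \<delta> t ^ d = W t" if t: "t \<ge> t0" for t
    using psi_power[of s "2 ^ t" d] ln_ge_1[OF t] d by (simp_all add: \<delta>_def W_def)
  have \<delta>_pow: "(2 ^ t * \<delta> t) ^ d = (2 ^ t) ^ (d - 1) * W t" if t: "t \<ge> t0" for t
  proof -
    have "(2 ^ t * \<delta> t) ^ d = (2 ^ t) ^ d * \<delta> t ^ d" by (rule power_mult_distrib)
    also have "((2::real) ^ t) ^ d = (2 ^ t) ^ (d - 1) * 2 ^ t" using d by (simp flip: power_Suc2)
    finally show ?thesis using psi_facts(2)[OF t] by (simp add: mult.assoc)
  qed
  have power_le_D: "a \<le> b" if "a ^ n \<le> b ^ n" "0 \<le> b" "n > 0" for a b :: real and n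
    using that power_strict_mono[of b a n] by (meson not_less)
  \<comment> \<open>In the \<open>d\<close>-th power a step gains \<open>2 ^ (d - 1) \<ge> 4\<close>
    from the power of 2 and loses at most 4 from \<open>W\<close>.\<close>
  have double_step: "2 ^ t * \<delta> t \<le> 2 ^ Suc t * \<delta> (Suc t)" if t: "t \<ge> t0" for t
  proof (rule power_le_D)
    have "(2 ^ t * \<delta> t) ^ d \<le> (2 ^ t) ^ (d - 1) * (4 * W (Suc t))"
      unfolding \<delta>_pow[OF t] using W_Suc[OF t] by (intro mult_left_mono) auto
    also have "\<dots> \<le> (2 ^ t) ^ (d - 1) * (2 ^ (d - 1) * W (Suc t))"
    proof (intro mult_left_mono mult_right_mono)
      show "(4::real) \<le> 2 ^ (d - 1)" using power_increasing[of 2 "d - 1" "2::real"] d by simp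
    qed (use W_pos[of "Suc t"] t in auto)
    also have "\<dots> = (2 ^ Suc t * \<delta> (Suc t)) ^ d"
      using \<delta>_pow[of "Suc t"] t by (simp add: power_mult_distrib)
    finally show "(2 ^ t * \<delta> t) ^ d \<le> (2 ^ Suc t * \<delta> (Suc t)) ^ d" .
  qed (use psi_facts(1)[of "Suc t"] t d in auto)
  have growth: "2 ^ t * \<delta> t \<le> 2 ^ u * \<delta> u" if "t0 \<le> t" "t \<le> u" for t u
    using that(2,1)
  proof (induction u rule: dec_induct)
    case (step n)
    show ?case
      by (rule order_trans[OF step.IH[OF step.prems] double_step]) (use step in simp)
  qed simp
  \<comment> \<open>Compare \<open>d\<close>-th powers: \<open>2 * (d - 1) - 1 \<ge> d\<close>
    because \<open>d \<ge> 3\<close>, and the remaining factor \<open>2 ^ t\<close> absorbs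
    \<open>(W t)\<^sup>2\<close>.\<close>
  have large: "2 ^ t \<le> (2 ^ t * \<delta> t)\<^sup>2" if t: "t \<ge> t0" for t
  proof (rule power_le_D)
    have "((2::real) ^ t) ^ d \<le> (2 ^ t) ^ (2 * (d - 1) - 1)"
      using d by (intro power_increasing) auto
    also have "\<dots> \<le> (2 ^ t) ^ (2 * (d - 1) - 1) * ((W t)\<^sup>2 * 2 ^ t)"
      using W_sq[OF t] by simp
    also have "\<dots> = ((2 ^ t) ^ (2 * (d - 1) - 1) * 2 ^ t) * (W t)\<^sup>2" by simp
    also have "(2 ^ t) ^ (2 * (d - 1) - 1) * 2 ^ t = ((2::real) ^ t) ^ (2 * (d - 1))"
      using d by (simp flip: power_Suc2)
    also have "\<dots> * (W t)\<^sup>2 = ((2 ^ t) ^ (d - 1) * W t)\<^sup>2"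
      by (simp add: power_mult_distrib mult.commute flip: power_mult)
    also have "\<dots> = ((2 ^ t * \<delta> t)\<^sup>2) ^ d"
      unfolding \<delta>_pow[OF t, symmetric] by (simp add: mult.commute flip: power_mult)
    finally show "(2 ^ t) ^ d \<le> ((2 ^ t * \<delta> t)\<^sup>2) ^ d" .
  qed (use d in auto)
  \<comment> \<open>The first inequality makes a block of length \<open>H\<close> fit among the
    denominators up to \<open>2 ^ (t - e)\<close>; the second gives
    \<open>\<delta> t * H \<ge> 1\<close>.\<close>
  define S where "S = {t. \<exists>H. separating x H \<and> 2 ^ e * H \<le> 2 ^ t \<and> 2 ^ t \<le> H\<^sup>2}"
  define T where "T = {t \<in> S. t \<ge> t0}"
  have card_I: "card {2..d} = d - 1" by simp
  interpret approximation_scales "{2..d}" x \<delta> T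
  proof
    show "{2..d} \<noteq> {}" using d by simp
    show "0 < \<delta> t" if "t \<in> T" for t using that psi_facts(1) by (simp add: T_def)
    show "2 ^ t * \<delta> t ^ (card {2..d} + 1) \<le> 1" if "t \<in> T" for t
      using that psi_facts(2)[of t] W_le_1[of t] d by (simp add: T_def)
    show "2 ^ t * \<delta> t \<le> 2 ^ u * \<delta> u" if "t \<in> T" "u \<in> T" "t \<le> u" for t u
      using that growth by (simp add: T_def)
    show "2 \<le> 2 ^ t * \<delta> t" if "t \<in> T" for t
    proof (rule power_le_D[of _ 2])
      have t: "t \<ge> t0" using that by (simp add: T_def)
      then have "(2::real) ^ 2 \<le> 2 ^ t" by (intro power_increasing) (auto simp: t0_def)
      then show "2\<^sup>2 \<le> (2 ^ t * \<delta> t)\<^sup>2" using large[OF t] by linarith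
      show "0 \<le> 2 ^ t * \<delta> t" using psi_facts(1)[OF t] by simp
    qed simp
    show "\<exists>t1. \<forall>t\<in>T. t1 \<le> t \<longrightarrow> B \<le> 2 ^ t * \<delta> t" for B
    proof (intro exI[of _ "nat \<lceil>B\<^sup>2\<rceil>"] ballI impI)
      fix t assume t: "t \<in> T" "nat \<lceil>B\<^sup>2\<rceil> \<le> t"
      have t': "t \<ge> t0" using t by (simp add: T_def)
      show "B \<le> 2 ^ t * \<delta> t"
      proof (rule power_le_D[of _ 2])
        have "B\<^sup>2 \<le> real t" using t(2) by linarith
        then show "B\<^sup>2 \<le> (2 ^ t * \<delta> t)\<^sup>2" using large[OF t'] t_less[of t] by linarith
        show "0 \<le> 2 ^ t * \<delta> t" using psi_facts(1)[OF t'] by simp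
      qed simp
    qed
    show "4 * card {2..d} + 7 \<le> t \<and>
       (\<exists>H. separating x H \<and> H \<le> 2 ^ (t - (4 * card {2..d} + 7)) \<and> 1 \<le> \<delta> t * H)" if tT: "t \<in> T" for t
    proof -
      have t: "t \<ge> t0" using that by (simp add: T_def)
      obtain H where H: "separating x H" "2 ^ e * H \<le> 2 ^ t" "2 ^ t \<le> H\<^sup>2"
        using tT by (auto simp: T_def S_def)
      have et: "e \<le> t" using t by (simp add: t0_def)
      have "2 ^ e * H \<le> 2 ^ e * 2 ^ (t - e)" using H(2) et by (simp flip: power_add)
      then have "H \<le> 2 ^ (t - e)" by simp
      moreover have "1 \<le> \<delta> t * H"
      \<comment> \<open>Here \<open>\<delta> t ^ (2 * d) = (W t / 2 ^ t)\<^sup>2\<close> and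
        \<open>H ^ (2 * d) \<ge> (2 ^ t) ^ d\<close>; as \<open>d \<ge> 3\<close>, a factor
        \<open>2 ^ t\<close> is left over to absorb \<open>(W t)\<^sup>2\<close>.\<close>
      proof (rule power_le_D[of _ "2 * d"])
        have "1 ^ (2 * d) \<le> (W t)\<^sup>2 * 2 ^ t" using W_sq[OF t] by simp
        also have "\<dots> = (W t)\<^sup>2 / (2 ^ t)\<^sup>2 * (2 ^ t) ^ 3"
          by (simp add: power2_eq_square power3_eq_cube)
        also have "\<dots> \<le> (W t)\<^sup>2 / (2 ^ t)\<^sup>2 * (2 ^ t) ^ d"
          using d by (intro mult_left_mono power_increasing) auto
        also have "\<dots> \<le> (W t)\<^sup>2 / (2 ^ t)\<^sup>2 * ((real H)\<^sup>2) ^ d"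
        proof (intro mult_left_mono power_mono)
          show "2 ^ t \<le> (real H)\<^sup>2" using H(3) by (metis of_nat_le_iff of_nat_numeral of_nat_power)
        qed auto
        also have "(W t)\<^sup>2 / (2 ^ t)\<^sup>2 = (\<delta> t ^ d)\<^sup>2"
          unfolding psi_facts(2)[OF t, symmetric] by (simp flip: power_divide)
        also have "(\<delta> t ^ d)\<^sup>2 * ((real H)\<^sup>2) ^ d = (\<delta> t * H) ^ (2 * d)"
          by (simp add: power_mult_distrib mult.commute flip: power_mult)
        finally show "1 ^ (2 * d) \<le> (\<delta> t * H) ^ (2 * d)" .
      qed (use psi_facts(1)[OF t] d in auto)
      ultimately show ?thesis using et H(1) unfolding e_def card_I by blast
    qed
  qed simp
  have W_div: "\<exists>b. B \<le> (\<Sum>t\<in>{a..<b}. W t)" if a: "a \<ge> t0" for B a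
  proof -
    define G where "G t = (ln ^^ Suc s) (2 ^ t :: real)" for t :: nat
    have "G b - G a \<le> (\<Sum>t\<in>{a..<b}. W t)" if "a \<le> b" for b
      using that
    proof (induction b rule: dec_induct)
      case (step b)
      have "G (Suc b) - G b \<le> W b"
        unfolding G_def W_def using ln_ge step a by (intro inverse_log_prod_ge_diff) auto
      then show ?case using step by simp
    qed simp
    moreover have "\<exists>b\<ge>a. B + G a \<le> G b"
    proof -
      obtain z0 where z0: "\<And>z. z \<ge> z0 \<Longrightarrow> B + G a \<le> (ln ^^ Suc s) z"
        using filterlim_ln_funpow[of "Suc s"] unfolding filterlim_at_top eventually_at_top_linorder by blast
      define b where "b = a + nat \<lceil>z0\<rceil>"
      have "z0 \<le> real b" unfolding b_def by linarith
      then have "z0 \<le> 2 ^ b" using t_less[of b] by linarith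
      then show ?thesis unfolding G_def using z0 by (intro exI[of _ b]) (auto simp: b_def G_def)
    qed
    ultimately show ?thesis by (meson add_le_imp_le_diff order_trans)
  qed
  have "AE y in lborel_PiM {2..d}. \<forall>t1. \<exists>t\<ge>t1. t \<in> T \<and>
     (\<exists>q. 2 ^ (t - (4 * card {2..d} + 7)) < q \<and> q \<le> 2 ^ t \<and> near t q \<and> (\<forall>i\<in>{2..d}. \<exists>p::int. \<bar>real q * y i - p\<bar> < \<delta> t))"
  proof (rule AE_approximable)
    fix B t1
    have "\<exists>F. finite F \<and> F \<subseteq> T \<inter> {t1..} \<and> B \<le> sum W F"
    proof (rule sum_over_dense_unbounded[where L = "2 * (2 * d)"])
      show "0 \<le> W t" if "t \<ge> t0" for t using W_pos[OF that] by simp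
      show "W u \<le> W t" if "t0 \<le> t" "t \<le> u" for t u by (rule W_anti[OF that])
      show "\<exists>b. B \<le> (\<Sum>t\<in>{a..<b}. W t)" if "a \<ge> t0" for B a by (rule W_div[OF that])
      show "2 \<le> 2 * (2 * d)" using d by simp
      show "a \<le> 2 * card (T \<inter> {a..<2 * (2 * d) * a})" if a: "a \<ge> t0" for a
      proof -
        have "T \<inter> {a..<2 * (2 * d) * a} = S \<inter> {a..<2 * (2 * d) * a}" using a by (auto simp: T_def)
        moreover have "a \<le> 2 * card (S \<inter> {a..<2 * (2 * d) * a})"
          unfolding S_def
        proof (rule dense_separating_scales[OF _ h0 badly])
          show "2 * e \<le> a" using a by (simp add: t0_def)
          have "h0 ^ 3 \<le> a" using a by (simp add: t0_def)
          then show "h0 ^ 3 \<le> 2 ^ a" using less_exp[of a] by linarith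
        qed (use d in auto)
        ultimately show ?thesis by simp
      qed
    qed
    then obtain F where F: "finite F" "F \<subseteq> T \<inter> {t1..}" "B \<le> sum W F" by blast
    have "sum W F = sum w F"
      using F(2) psi_facts(2) d by (intro sum.cong) (auto simp: w_def T_def)
    then show "\<exists>F. finite F \<and> F \<subseteq> T \<inter> {t1..} \<and> B \<le> sum w F" using F by auto
  qed
  then show ?thesis
  proof (rule AE_mp, intro AE_I2 impI)
    fix y assume y: "y \<in> space (lborel_PiM {2..d})"
      and approx: "\<forall>t1. \<exists>t\<ge>t1. t \<in> T \<and>
     (\<exists>q. 2 ^ (t - (4 * card {2..d} + 7)) < q \<and> q \<le> 2 ^ t \<and> near t q \<and> (\<forall>i\<in>{2..d}. \<exists>p::int. \<bar>real q * y i - p\<bar> < \<delta> t))"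
    show "y(1 := x) \<in> well_approx d (psi s d)"
    proof (rule well_approxI)
      show "1 \<le> d" using d by simp
      show "y(1 := x) \<in> {1..d} \<rightarrow>\<^sub>E UNIV"
        using y d by (auto simp: space_PiM PiE_iff extensional_def)
      fix n
      obtain t q where t: "t \<ge> n + e + nat \<lceil>Z\<rceil>" "t \<in> T" and q: "2 ^ (t - e) < q" "q \<le> 2 ^ t" "near t q"
        "\<forall>i\<in>{2..d}. \<exists>p::int. \<bar>real q * y i - p\<bar> < \<delta> t"
        using approx unfolding card_I e_def[symmetric] by blast
      \<comment> \<open>The lower bound \<open>q > 2 ^ (t - e)\<close> forces the denominators to
        infinity with \<open>t\<close>, so infinitely many of them arise.\<close>
      have q_ge: "q \<ge> n + nat \<lceil>Z\<rceil>" using q(1) less_exp[of "t - e"] t(1) by linarith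
      then have "real q \<ge> Z" by linarith
      then have "(ln ^^ k) (real q) \<ge> 1" if "k \<le> s" for k using Z[of "real q"] that by auto
      \<comment> \<open>Beyond \<open>Z\<close> the function \<open>psi s d\<close> decreases, so
        the error allowed at \<open>2 ^ t\<close> is allowed at
        \<open>q \<le> 2 ^ t\<close>.\<close>
      then have \<delta>_le: "\<delta> t \<le> psi s d q" unfolding \<delta>_def using d q(2) by (intro psi_antimono) auto
      have "\<exists>p::int. \<bar>real q * (y(1 := x)) i - p\<bar> < psi s d q" if i: "i \<in> {1..d}" for i
      proof (cases "i = 1")
        case True
        then show ?thesis using q(3) \<delta>_le unfolding near_def by (auto intro: order_less_le_trans)
      next
        case False
        then have "i \<in> {2..d}" using i by auto
        with q(4) obtain p :: int where "\<bar>real q * y i - p\<bar> < \<delta> t" by blast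
        then show ?thesis using False \<delta>_le by (intro exI[of _ p]) simp
      qed
      then show "\<exists>q\<ge>n. 1 \<le> q \<and> (\<forall>i\<in>{1..d}. \<exists>p::int. \<bar>real q * (y(1 := x)) i - p\<bar> < psi s d q)"
        using q_ge q(1) by (intro exI[of _ q]) auto
    qed
  qed
qed

theorem theorem2:
  fixes d s :: nat and x :: real
  assumes "d \<ge> 3" and "s \<ge> 1"
    and "diophantine_type x > ereal (real d) \<or>
         (x \<notin> \<rat> \<and> regular_diophantine_type x > 1)"
  shows "AE y in (\<Pi>\<^sub>M i\<in>{2..d}. (lborel :: real measure)).
           y(1 := x) \<in> well_approx d (psi s d)"
proof (cases "\<exists>h0\<ge>1. \<forall>h\<ge>h0. \<forall>p::int. \<bar>real h * x - p\<bar> \<ge> 1 / real h ^ (2 * d)")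
  case True
  then show ?thesis
    using AE_well_approx_if_not_very_well_approximable[OF assms(1)] by blast
next
  case False
  have very_well: "\<exists>h\<ge>n. \<exists>p::int. \<bar>real h * x - p\<bar> < 1 / real h ^ (2 * d)" for n
    using False by (auto simp: not_le dest!: spec[of _ "max n 1"])
  show ?thesis
  proof (rule AE_I2)
    fix y assume "y \<in> space (\<Pi>\<^sub>M i\<in>{2..d}. (lborel :: real measure))"
    then have "y(1 := x) \<in> {1..d} \<rightarrow>\<^sub>E UNIV"
      using assms(1) by (auto simp: space_PiM PiE_iff extensional_def)
    then show "y(1 := x) \<in> well_approx d (psi s d)"
      using assms(1) very_well by (intro well_approx_if_very_well_approximable[where x = x]) auto
  qed
qed

end
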